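(* Consider the parallel MIMO channel $$\mathbf y_k=\boldsymbol\Pi_k\,\mathbf x_k+\mathbf z_k,\qquad k=1,\ldots,K,$$ with $\boldsymbol\Pi_k\in\mathbb C^{n_{{\rm r},k}\times n_{{\rm t},k}}$. Parallel NVD codes are approximately universal over this channel, i.e. a parallel NVD code achieves the DMT of the parallel channel whatever the fading statistics of $(\boldsymbol\Pi_1,\ldots,\boldsymbol\Pi_K)$.
   Context: The noises $\mathbf z_k$ have i.i.d. $\mathcal{CN}(0,1)$ entries, the fading matrices $\boldsymbol\Pi_k$ are random, constant over the codeword and known to the receiver only; transmitted codewords are scaled to satisfy an average power constraint of order $\mathsf{SNR}$. A code $\mathcal X$ for the parallel channel is a set of codewords $\{\mathbf X_k\}_{k=1}^K$ with $\mathbf X_k\in\mathbb C^{n_{{\rm t},k}\times T}$, $\mathbf X_k$ being sent over sub-channel $k$. Notation: $q\doteq\mathsf{SNR}^a$ means $\lim_{\mathsf{SNR}\to\infty}\log q/\log\mathsf{SNR}=a$; similarly $\dot\le$. Parallel NVD code: let $\mathcal B$ be a scalably dense alphabet, i.e. for $0\le a\le1$, $|\mathcal B(\mathsf{SNR})|\doteq\mathsf{SNR}^a$ and $s\in\mathcal B(\mathsf{SNR})\Rightarrow|s|^2\,\dot\le\,\mathsf{SNR}^a$. A parallel code $\mathcal X$ is a parallel NVD (non-vanishing determinant) code if: (1) it is $\mathcal B$-linear, i.e. each entry of any codeword is a linear combination of symbols from $\mathcal B$; (2) it has full symbol rate, i.e. it transmits on average $\sum_k n_{{\rm t},k}$ symbols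 from $\mathcal B$ per channel use (of the whole parallel channel); (3) for any pair of different codewords $\{\mathbf X_k\}_k,\{\hat{\mathbf X}_k\}_k\in\mathcal X$, $$\prod_{k}\det\big((\mathbf X_k-\hat{\mathbf X}_k)(\mathbf X_k-\hat{\mathbf X}_k)^\dagger\big)\ge\kappa>0$$ with $\kappa$ a constant independent of $\mathsf{SNR}$. The data rate $R=r\log\mathsf{SNR}$ is set through the alphabet size. DMT of the parallel channel: $d(r)$ is given by $\mathsf P\{\sum_{k=1}^K\log\det(\mathbf I+\mathsf{SNR}\,\boldsymbol\Pi_k\boldsymbol\Pi_k^\dagger)<r\log\mathsf{SNR}\}\doteq\mathsf{SNR}^{-d(r)}$, with rates counted per use of the whole parallel channel. A code achieves the DMT if its error probability $P_{\rm e}$ under maximum likelihood decoding at rate $r\log\mathsf{SNR}$ satisfies $P_{\rm e}\,\dot\le\,\mathsf{SNR}^{-d(r)}$. Approximately universal means that the DMT is achieved for every fading statistics.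
   Formalization: Proved for multiplexing gains 0 < r ≤ Σ n_{t,k} at which d is right-continuous. At a jump of d (e.g. one Rayleigh and one constant scalar sub-channel, r = 1) or at r = 0 (where the outage event is empty, so d = ∞) the claim as stated can fail. *)

theory Defs
  imports "HOL-Probability.Probability" "Jordan_Normal_Form.Schur_Decomposition"
begin

text \<open>
  The sub-channels are indexed by a finite type \<open>'k\<close> (so \<open>K = CARD('k)\<close>); since the dimensions
  \<open>nt k\<close>, \<open>nr k\<close> vary with \<open>k\<close>, matrices are those of Jordan_Normal_Form.
\<close>

section \<open>Exponential order\<close>

text \<open>
  The logarithm takes the value \<open>-\<infinity>\<close> at 0 (where \<open>ln\<close> is 0), so that a probability that vanishes
  or decays faster than every power of SNR has exponent \<open>-\<infinity>\<close>.
\<close>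

definition elog :: "real \<Rightarrow> ereal" where
  "elog x = (if x \<le> 0 then -\<infinity> else ereal (ln x))"

definition exp_eq :: "(real \<Rightarrow> real) \<Rightarrow> ereal \<Rightarrow> bool" where
  "exp_eq q a \<longleftrightarrow> ((\<lambda>snr. elog (q snr) / ereal (ln snr)) \<longlongrightarrow> a) at_top"

definition exp_le :: "(real \<Rightarrow> real) \<Rightarrow> ereal \<Rightarrow> bool" where
  "exp_le q a \<longleftrightarrow> Limsup at_top (\<lambda>snr. elog (q snr) / ereal (ln snr)) \<le> a"

section \<open>Parallel NVD codes\<close>

type_synonym 'k codeword = "'k \<Rightarrow> complex mat"

text \<open>
  \<open>B a snr\<close> is the alphabet of size exponent \<open>a\<close>. An alphabet that is empty or infinite for
  arbitrarily large SNR is excluded by the first condition, as \<open>card\<close> is then 0. The bound on the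
  energy of the symbols is uniform over the alphabet.
\<close>

definition scalably_dense :: "(real \<Rightarrow> real \<Rightarrow> complex set) \<Rightarrow> bool" where
  "scalably_dense B \<longleftrightarrow> (\<forall>a. 0 \<le> a \<and> a \<le> 1 \<longrightarrow>
     exp_eq (\<lambda>snr. real (card (B a snr))) (ereal a) \<and>
     exp_le (\<lambda>snr. Max ((\<lambda>s. (cmod s)\<^sup>2) ` B a snr)) (ereal a))"

definition linear_codeword ::
  "('k \<Rightarrow> nat) \<Rightarrow> nat \<Rightarrow> nat \<Rightarrow> ('k \<Rightarrow> nat \<Rightarrow> nat \<Rightarrow> nat \<Rightarrow> complex) \<Rightarrow> (nat \<Rightarrow> complex) \<Rightarrow> 'k codeword"
where
  "linear_codeword nt T L W s = (\<lambda>k. mat (nt k) T (\<lambda>(i, j). \<Sum>l<L. W k i j l * s l))"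

text \<open>
  \<open>Bs\<close> and \<open>X\<close> are the alphabet and the code as functions of SNR. The coefficients \<open>W\<close> of the
  linear combinations do not depend on SNR. Full symbol rate: \<open>T * (\<Sum>k. nt k)\<close> free symbols are
  conveyed (injectively) in the \<open>T\<close> channel uses of a codeword. The determinants are those of
  Gram matrices, hence real.
\<close>

definition parallel_nvd_code ::
  "('k::finite \<Rightarrow> nat) \<Rightarrow> nat \<Rightarrow> (real \<Rightarrow> complex set) \<Rightarrow> (real \<Rightarrow> 'k codeword set) \<Rightarrow> bool"
where
  "parallel_nvd_code nt T Bs X \<longleftrightarrow>
     (\<exists>W. \<forall>\<^sub>F snr in at_top.
        let L = T * (\<Sum>k\<in>UNIV. nt k) in
          X snr = linear_codeword nt T L W ` ({..<L} \<rightarrow>\<^sub>E Bs snr) \<and>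
          inj_on (linear_codeword nt T L W) ({..<L} \<rightarrow>\<^sub>E Bs snr)) \<and>
     (\<exists>\<kappa>>0. \<forall>\<^sub>F snr in at_top. \<forall>x\<in>X snr. \<forall>x'\<in>X snr. x \<noteq> x' \<longrightarrow>
        \<kappa> \<le> (\<Prod>k\<in>UNIV. Re (det ((x k - x' k) * mat_adjoint (x k - x' k)))))"

text \<open>Average power per channel use of the code \<open>C\<close> scaled by \<open>\<theta>\<close>.\<close>

definition avg_power :: "('k::finite \<Rightarrow> nat) \<Rightarrow> nat \<Rightarrow> real \<Rightarrow> 'k codeword set \<Rightarrow> real" where
  "avg_power nt T \<theta> C =
     (\<Sum>x\<in>C. \<Sum>k\<in>UNIV. \<Sum>i<nt k. \<Sum>j<T. (cmod (complex_of_real \<theta> * x k $$ (i, j)))\<^sup>2)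
       / (real T * real (card C))"

section \<open>The parallel channel\<close>

definition fading ::
  "('k \<Rightarrow> nat) \<Rightarrow> ('k \<Rightarrow> nat) \<Rightarrow> 'w measure \<Rightarrow> ('w \<Rightarrow> 'k \<Rightarrow> complex mat) \<Rightarrow> bool"
where
  "fading nt nr M H \<longleftrightarrow> prob_space M \<and>
     (\<forall>k. (\<forall>\<omega>\<in>space M. H \<omega> k \<in> carrier_mat (nr k) (nt k)) \<and>
          (\<forall>i<nr k. \<forall>j<nt k. (\<lambda>\<omega>. H \<omega> k $$ (i, j)) \<in> borel_measurable M))"

definition cn_pdf :: "complex \<Rightarrow> real" where
  "cn_pdf z = exp (- (cmod z)\<^sup>2) / pi"

definition noise_index :: "('k \<Rightarrow> nat) \<Rightarrow> nat \<Rightarrow> ('k \<times> nat \<times> nat) set" where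
  "noise_index nr T = {(k, i, j). i < nr k \<and> j < T}"

definition noise :: "('k \<Rightarrow> nat) \<Rightarrow> nat \<Rightarrow> ('k \<times> nat \<times> nat \<Rightarrow> complex) measure" where
  "noise nr T = PiM (noise_index nr T) (\<lambda>_. density lborel (\<lambda>z. ennreal (cn_pdf z)))"

definition noise_mat ::
  "('k \<Rightarrow> nat) \<Rightarrow> nat \<Rightarrow> ('k \<times> nat \<times> nat \<Rightarrow> complex) \<Rightarrow> 'k \<Rightarrow> complex mat"
where
  "noise_mat nr T z k = mat (nr k) T (\<lambda>(i, j). z (k, i, j))"

definition received ::
  "('k \<Rightarrow> nat) \<Rightarrow> nat \<Rightarrow> real \<Rightarrow> ('k \<Rightarrow> complex mat) \<Rightarrow> 'k codeword
     \<Rightarrow> ('k \<times> nat \<times> nat \<Rightarrow> complex) \<Rightarrow> 'k \<Rightarrow> complex mat"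
where
  "received nr T \<theta> H x z k = H k * (complex_of_real \<theta> \<cdot>\<^sub>m x k) + noise_mat nr T z k"

definition outage_prob ::
  "('k::finite \<Rightarrow> nat) \<Rightarrow> 'w measure \<Rightarrow> ('w \<Rightarrow> 'k \<Rightarrow> complex mat) \<Rightarrow> real \<Rightarrow> real \<Rightarrow> real"
where
  "outage_prob nr M H r snr = measure M {\<omega> \<in> space M.
     (\<Sum>k\<in>UNIV. ln (Re (det (1\<^sub>m (nr k) +
        complex_of_real snr \<cdot>\<^sub>m (H \<omega> k * mat_adjoint (H \<omega> k)))))) < r * ln snr}"

text \<open>
  \<open>r = 0\<close> is left out because the outage event is then empty. An outage probability that vanishes
  or decays faster than every power of SNR is allowed, with \<open>d r = \<infinity>\<close>. For some fading statistics
  \<open>d\<close> jumps: two scalar sub-channels, the first Rayleigh and the second constantly 1, have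
  \<open>d r = \<infinity>\<close> for \<open>r \<le> 1\<close> and \<open>d r = 2 - r\<close> for \<open>1 < r \<le> 2\<close>. As all quantities are only
  specified up to sub-polynomial factors, no code can be guaranteed to achieve more than the right
  limit of \<open>d\<close> at such an \<open>r\<close>.
\<close>

definition is_dmt ::
  "('k::finite \<Rightarrow> nat) \<Rightarrow> 'w measure \<Rightarrow> ('w \<Rightarrow> 'k \<Rightarrow> complex mat) \<Rightarrow> (real \<Rightarrow> ereal) \<Rightarrow> bool"
where
  "is_dmt nr M H d \<longleftrightarrow> (\<forall>r>0. exp_eq (outage_prob nr M H r) (- d r))"

section \<open>Maximum likelihood decoding\<close>

text \<open>Conditional density of the received matrices \<open>Y\<close> given the codeword \<open>x\<close> and the fading \<open>H\<close>.\<close>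

definition likelihood ::
  "('k::finite \<Rightarrow> nat) \<Rightarrow> nat \<Rightarrow> real \<Rightarrow> ('k \<Rightarrow> complex mat) \<Rightarrow> ('k \<Rightarrow> complex mat)
     \<Rightarrow> 'k codeword \<Rightarrow> real"
where
  "likelihood nr T \<theta> H Y x = (\<Prod>k\<in>UNIV. \<Prod>i<nr k. \<Prod>j<T.
     cn_pdf ((Y k - H k * (complex_of_real \<theta> \<cdot>\<^sub>m x k)) $$ (i, j)))"

text \<open>
  A decoder \<open>D\<close> maps the known fading and the received matrices to a codeword; ties may be broken
  arbitrarily. The decoding events are required to be measurable because \<open>measure\<close> would give 0
  to the error event otherwise.
\<close>

definition ml_decoder ::
  "('k::finite \<Rightarrow> nat) \<Rightarrow> ('k \<Rightarrow> nat) \<Rightarrow> nat \<Rightarrow> 'w measure \<Rightarrow> ('w \<Rightarrow> 'k \<Rightarrow> complex mat) \<Rightarrow> real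
     \<Rightarrow> 'k codeword set \<Rightarrow> (('k \<Rightarrow> complex mat) \<Rightarrow> ('k \<Rightarrow> complex mat) \<Rightarrow> 'k codeword) \<Rightarrow> bool"
where
  "ml_decoder nt nr T M H \<theta> C D \<longleftrightarrow>
     (\<forall>G Y. (\<forall>k. G k \<in> carrier_mat (nr k) (nt k) \<and> Y k \<in> carrier_mat (nr k) T) \<longrightarrow>
        D G Y \<in> C \<and> (\<forall>x\<in>C. likelihood nr T \<theta> G Y x \<le> likelihood nr T \<theta> G Y (D G Y))) \<and>
     (\<forall>x\<in>C. \<forall>x'\<in>C. {(\<omega>, z) \<in> space (M \<Otimes>\<^sub>M noise nr T).
        D (H \<omega>) (received nr T \<theta> (H \<omega>) x z) = x'} \<in> sets (M \<Otimes>\<^sub>M noise nr T))"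

text \<open>
  Codewords are equiprobable, and the noise is independent of the fading (product measure).
\<close>

definition error_prob ::
  "('k \<Rightarrow> nat) \<Rightarrow> nat \<Rightarrow> 'w measure \<Rightarrow> ('w \<Rightarrow> 'k \<Rightarrow> complex mat) \<Rightarrow> real
     \<Rightarrow> 'k codeword set \<Rightarrow> (('k \<Rightarrow> complex mat) \<Rightarrow> ('k \<Rightarrow> complex mat) \<Rightarrow> 'k codeword) \<Rightarrow> real"
where
  "error_prob nr T M H \<theta> C D =
     (\<Sum>x\<in>C. measure (M \<Otimes>\<^sub>M noise nr T) {(\<omega>, z) \<in> space (M \<Otimes>\<^sub>M noise nr T).
        D (H \<omega>) (received nr T \<theta> (H \<omega>) x z) \<noteq> x}) / real (card C)"

text \<open>
  \<open>X\<close> is the code at multiplexing gain \<open>r\<close>, \<open>\<theta>\<close> any scaling giving an average power of order SNR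
  and \<open>D\<close> any maximum likelihood decoder.
\<close>

definition achieves_diversity ::
  "('k::finite \<Rightarrow> nat) \<Rightarrow> ('k \<Rightarrow> nat) \<Rightarrow> nat \<Rightarrow> 'w measure \<Rightarrow> ('w \<Rightarrow> 'k \<Rightarrow> complex mat)
     \<Rightarrow> (real \<Rightarrow> 'k codeword set) \<Rightarrow> ereal \<Rightarrow> bool"
where
  "achieves_diversity nt nr T M H X \<delta> \<longleftrightarrow> (\<forall>\<theta> D.
     exp_eq (\<lambda>snr. avg_power nt T (\<theta> snr) (X snr)) 1 \<longrightarrow>
     (\<forall>\<^sub>F snr in at_top. ml_decoder nt nr T M H (\<theta> snr) (X snr) (D snr)) \<longrightarrow>
     exp_le (\<lambda>snr. error_prob nr T M H (\<theta> snr) (X snr) (D snr)) (- \<delta>))"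

end

theory Submission
  imports Defs "HOL-Real_Asymp.Real_Asymp"
begin

text \<open>
  Let \<open>D k\<close> be the difference of two codewords and put \<open>A k = D k * (D k)\<^sup>\<dagger>\<close> and
  \<open>P k = 1 + snr * (H k)\<^sup>\<dagger> * H k\<close>. The eigenvalues of \<open>A k * P k\<close> are nonnegative, and over all
  sub-channels there are \<open>n = (\<Sum>k. nt k)\<close> of them. Each is at most their sum
  \<open>S = (\<Sum>k. \<parallel>D k\<parallel>\<^sup>2) + snr * (\<Sum>k. \<parallel>H k * D k\<parallel>\<^sup>2)\<close>, so their product \<open>(\<Prod>k. det (A k) * det (P k))\<close>
  is at most \<open>S ^ n\<close>. Outside the outage event at a rate \<open>r' > r\<close> this product is at least
  \<open>\<kappa> * snr powr r'\<close>, whereas \<open>\<parallel>D k\<parallel>\<^sup>2\<close> is of order at most \<open>snr powr (r / n)\<close>. Hence the received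
  distance \<open>\<theta>\<^sup>2 * (\<Sum>k. \<parallel>H k * D k\<parallel>\<^sup>2)\<close> grows like a positive power of SNR, and a decoding error then
  requires a noise norm whose probability decays faster than every power of SNR. Thus the error
  probability has exponent at least \<open>d r'\<close> for every \<open>r' > r\<close>, and \<open>r'\<close> tends to \<open>r\<close>.
\<close>

section \<open>Determinants and traces of Gram matrices\<close>

definition mat_trace :: "'a::comm_ring_1 mat \<Rightarrow> 'a" where
  "mat_trace A = (\<Sum>i<dim_row A. A $$ (i, i))"

definition frob2 :: "complex mat \<Rightarrow> real" where
  "frob2 A = (\<Sum>i<dim_row A. \<Sum>j<dim_col A. (cmod (A $$ (i, j)))\<^sup>2)"

lemma frob2_nonneg: "0 \<le> frob2 A"
  by (simp add: frob2_def sum_nonneg)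

section \<open>Adjoints, traces and the Hermitian inner product\<close>

lemma dim_mat_adjoint [simp]:
  "dim_row (mat_adjoint A) = dim_col A" "dim_col (mat_adjoint A) = dim_row A"
  by (simp_all add: mat_adjoint_def)

lemma mat_adjoint_carrier [simp]: "A \<in> carrier_mat n m \<Longrightarrow> mat_adjoint A \<in> carrier_mat m n"
  by (metis carrier_matD carrier_matI dim_mat_adjoint)

lemma index_mat_adjoint [simp]:
  "i < dim_col A \<Longrightarrow> j < dim_row A \<Longrightarrow> mat_adjoint A $$ (i, j) = conjugate (A $$ (j, i))"
  by (simp add: mat_adjoint_def mat_of_rows_def)

lemma mat_adjoint_mult:
  fixes A B :: "complex mat"
  assumes "A \<in> carrier_mat n m" "B \<in> carrier_mat m p"
  shows "mat_adjoint (A * B) = mat_adjoint B * mat_adjoint A"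
  using assms by (intro eq_matI) (auto simp: scalar_prod_def mult.commute intro!: sum.cong)

lemma cscalar_prod_adjoint:
  fixes A :: "complex mat"
  assumes A: "A \<in> carrier_mat n m" and v: "v \<in> carrier_vec m" and w: "w \<in> carrier_vec n"
  shows "(A *\<^sub>v v) \<bullet>c w = v \<bullet>c (mat_adjoint A *\<^sub>v w)"
proof -
  have "(A *\<^sub>v v) \<bullet>c w = (\<Sum>i<n. \<Sum>j<m. A $$ (i, j) * v $ j * cnj (w $ i))"
    using assms by (simp add: scalar_prod_def sum_distrib_right lessThan_atLeast0)
  also have "\<dots> = (\<Sum>j<m. \<Sum>i<n. A $$ (i, j) * v $ j * cnj (w $ i))"
    by (rule sum.swap)
  also have "\<dots> = v \<bullet>c (mat_adjoint A *\<^sub>v w)"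
    using assms by (simp add: scalar_prod_def sum_distrib_left lessThan_atLeast0 mult_ac)
  finally show ?thesis .
qed

lemma mat_trace_comm:
  assumes "A \<in> carrier_mat n m" "B \<in> carrier_mat m n"
  shows "mat_trace (A * B) = mat_trace (B * A)"
proof -
  have "mat_trace (A * B) = (\<Sum>i<n. \<Sum>j<m. A $$ (i, j) * B $$ (j, i))"
    using assms by (simp add: mat_trace_def scalar_prod_def lessThan_atLeast0)
  also have "\<dots> = (\<Sum>j<m. \<Sum>i<n. A $$ (i, j) * B $$ (j, i))"
    by (rule sum.swap)
  also have "\<dots> = mat_trace (B * A)"
    using assms by (simp add: mat_trace_def scalar_prod_def lessThan_atLeast0 mult.commute)
  finally show ?thesis .
qed

lemma mat_trace_gram: "mat_trace (mat_adjoint E * E) = complex_of_real (frob2 E)"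
proof -
  have "mat_trace (mat_adjoint E * E) =
      (\<Sum>j<dim_col E. \<Sum>i<dim_row E. complex_of_real ((cmod (E $$ (i, j)))\<^sup>2))"
    unfolding complex_norm_square by (simp add: mat_trace_def scalar_prod_def lessThan_atLeast0 mult.commute)
  also have "\<dots> = complex_of_real (frob2 E)"
    unfolding frob2_def by (subst sum.swap) simp
  finally show ?thesis .
qed

text \<open>Sylvester's identity. Multiplying the block matrix \<open>?M\<close> on the left by the
  unipotent \<open>?U\<close> clears its upper right block, and by \<open>?V\<close> its lower left
  block; the two sides are the two resulting values of \<open>det ?M\<close>.\<close>

lemma det_one_plus_mult_commute:
  fixes A B :: "complex mat"
  assumes A: "A \<in> carrier_mat n m" and B: "B \<in> carrier_mat m n"
  shows "det (1\<^sub>m n + A * B) = det (1\<^sub>m m + B * A)"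
proof -
  let ?M = "four_block_mat (1\<^sub>m n) (- A) B (1\<^sub>m m)"
  let ?U = "four_block_mat (1\<^sub>m n) A (0\<^sub>m m n) (1\<^sub>m m)"
  let ?V = "four_block_mat (1\<^sub>m n) (0\<^sub>m n m) (- B) (1\<^sub>m m)"
  have M: "?M \<in> carrier_mat (n + m) (n + m)" and U: "?U \<in> carrier_mat (n + m) (n + m)"
    and V: "?V \<in> carrier_mat (n + m) (n + m)"
    using A B by auto
  have "?U * ?M = four_block_mat (1\<^sub>m n + A * B) (0\<^sub>m n m) B (1\<^sub>m m)"
    by (subst mult_four_block_mat[of _ n n _ m _ m _ _ n _ m])
       (use A B in \<open>auto simp: uminus_l_inv_mat\<close>)
  moreover have "det (four_block_mat (1\<^sub>m n + A * B) (0\<^sub>m n m) B (1\<^sub>m m)) = det (1\<^sub>m n + A * B)"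
    by (subst det_four_block_mat_upper_right_zero) (use A B in auto)
  moreover have "?V * ?M = four_block_mat (1\<^sub>m n) (- A) (0\<^sub>m m n) (1\<^sub>m m + B * A)"
    by (subst mult_four_block_mat[of _ n n _ m _ m _ _ n _ m])
       (use A B in \<open>auto simp: uminus_l_inv_mat comm_add_mat[of _ m m]\<close>)
  moreover have "det (four_block_mat (1\<^sub>m n) (- A) (0\<^sub>m m n) (1\<^sub>m m + B * A)) = det (1\<^sub>m m + B * A)"
    by (subst det_four_block_mat_lower_left_zero) (use A B in auto)
  moreover have "det ?U = 1"
    by (subst det_four_block_mat_lower_left_zero) (use A B in auto)
  moreover have "det ?V = 1"
    by (subst det_four_block_mat_upper_right_zero) (use A B in auto)
  ultimately show ?thesis
    using det_mult[OF U M] det_mult[OF V M] by simp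
qed

text \<open>Schur triangularisation puts the roots of the characteristic polynomial, with
  multiplicity, on the diagonal of a similar matrix, and similarity preserves determinant and
  trace.\<close>

lemma det_trace_eigenvalues:
  fixes A :: "complex mat"
  assumes A: "A \<in> carrier_mat n n"
  obtains es where "length es = n" "\<And>e. e \<in> set es \<Longrightarrow> eigenvalue A e"
    "det A = prod_list es" "mat_trace A = sum_list es"
proof -
  obtain es where es: "char_poly A = (\<Prod>a\<leftarrow>es. [:- a, 1:])" and len: "length es = n"
    using char_poly_factorized[OF A] by blast
  obtain S P Q where S: "schur_decomposition A es = (S, P, Q)"
    by (cases "schur_decomposition A es")
  from schur_decomposition[OF A es S]
  have sim: "similar_mat_wit A S P Q" and up: "upper_triangular S" and diag: "diag_mat S = es"
    by auto
  note wit = similar_mat_witD2[OF A sim]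
  have "det A = det S"
    using det_similar similar_mat_def sim by blast
  also have "\<dots> = prod_list es"
    using det_upper_triangular[OF up wit(5)] diag by simp
  finally have 1: "det A = prod_list es" .
  have "mat_trace A = mat_trace (P * (S * Q))"
    using wit by (simp add: assoc_mult_mat[of _ n n _ n _ n])
  also have "\<dots> = mat_trace (S * Q * P)"
    by (rule mat_trace_comm[of _ n n]) (use wit in auto)
  also have "S * Q * P = S"
    using wit by (simp add: assoc_mult_mat[of _ n n _ n _ n])
  also have "mat_trace S = sum_list (diag_mat S)"
    by (simp add: mat_trace_def diag_mat_def sum_list_sum_nth lessThan_atLeast0)
  finally have 2: "mat_trace A = sum_list es" using diag by simp
  have "eigenvalue A e" if "e \<in> set es" for e
    unfolding eigenvalue_root_char_poly[OF A] es poly_prod_list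
    using that by (auto simp: prod_list_zero_iff)
  with len 1 2 show ?thesis using that by blast
qed

section \<open>Positivity of the spectrum of products of Gram matrices\<close>

lemma smult_mult_mat_vec:
  fixes A :: "'a::comm_ring_1 mat"
  assumes "A \<in> carrier_mat n m" "v \<in> carrier_vec m"
  shows "(k \<cdot>\<^sub>m A) *\<^sub>v v = k \<cdot>\<^sub>v (A *\<^sub>v v)"
  using assms by (intro eq_vecI) (auto simp: scalar_prod_def sum_distrib_left mult.assoc)

text \<open>The quadratic form of \<open>P\<close> at \<open>v\<close> is the squared norm of
  \<open>v\<close> plus \<open>c\<close> times that of \<open>H *\<^sub>v v\<close>.\<close>

lemma gram_mult_pos:
  fixes D H :: "complex mat" and c :: real
  assumes H: "H \<in> carrier_mat m n" and v: "v \<in> carrier_vec n" "v \<noteq> 0\<^sub>v n" and c: "0 \<le> c"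
  defines "P \<equiv> 1\<^sub>m n + complex_of_real c \<cdot>\<^sub>m (mat_adjoint H * H)"
  shows "0 < v \<bullet>c (P *\<^sub>v v)"
proof -
  have HH: "mat_adjoint H * H \<in> carrier_mat n n" using H by auto
  have Hv: "H *\<^sub>v v \<in> carrier_vec m" using H v by auto
  have HHv: "mat_adjoint H *\<^sub>v (H *\<^sub>v v) \<in> carrier_vec n"
    using H Hv by (meson mat_adjoint_carrier mult_mat_vec_carrier)
  have "P *\<^sub>v v = v + complex_of_real c \<cdot>\<^sub>v (mat_adjoint H *\<^sub>v (H *\<^sub>v v))"
    unfolding P_def assoc_mult_mat_vec[OF mat_adjoint_carrier[OF H] H v(1), symmetric]
      smult_mult_mat_vec[OF HH v(1), symmetric]
    using HH v by (subst add_mult_distrib_mat_vec[of _ n n]) simp_all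
  then have "v \<bullet>c (P *\<^sub>v v) = v \<bullet>c v + complex_of_real c * (v \<bullet>c (mat_adjoint H *\<^sub>v (H *\<^sub>v v)))"
    using v HHv by (simp add: conjugate_add_vec[of _ n] scalar_prod_add_distrib[of _ n] conjugate_smult_vec)
  also have "v \<bullet>c (mat_adjoint H *\<^sub>v (H *\<^sub>v v)) = (H *\<^sub>v v) \<bullet>c (H *\<^sub>v v)"
    by (rule cscalar_prod_adjoint[OF H v(1) Hv, symmetric])
  finally have eq: "v \<bullet>c (P *\<^sub>v v) = v \<bullet>c v + complex_of_real c * ((H *\<^sub>v v) \<bullet>c (H *\<^sub>v v))" .
  have "0 < v \<bullet>c v" using v by simp
  moreover have "0 \<le> (H *\<^sub>v v) \<bullet>c (H *\<^sub>v v)"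
    using conjugate_square_ge_0_vec .
  ultimately have "0 < v \<bullet>c v" "0 \<le> complex_of_real c * ((H *\<^sub>v v) \<bullet>c (H *\<^sub>v v))"
    using c by (simp_all add: less_eq_complex_def)
  then show ?thesis unfolding eq by (rule add_pos_nonneg)
qed

text \<open>The product of two Hermitian matrices need not be Hermitian, so the sign comes from a
  pairing: if \<open>v\<close> is an eigenvector and \<open>w = P *\<^sub>v v\<close>, then
  \<open>e * (v \<bullet>c w)\<close> is the squared norm of
  \<open>mat_adjoint D *\<^sub>v w\<close>, while \<open>v \<bullet>c w\<close> is positive. In the
  order on complex numbers \<open>0 \<le> e\<close> also says that \<open>e\<close> is real.\<close>

lemma eigenvalue_gram_mult_nonneg:
  fixes D H :: "complex mat" and c :: real
  assumes D: "D \<in> carrier_mat n t" and H: "H \<in> carrier_mat m n" and c: "0 \<le> c"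
    and ev: "eigenvalue (D * mat_adjoint D *
               (1\<^sub>m n + complex_of_real c \<cdot>\<^sub>m (mat_adjoint H * H))) e"
  shows "0 \<le> e"
proof -
  define P where "P = 1\<^sub>m n + complex_of_real c \<cdot>\<^sub>m (mat_adjoint H * H)"
  have P: "P \<in> carrier_mat n n" using H by (auto simp: P_def)
  obtain v where v: "v \<in> carrier_vec n" "v \<noteq> 0\<^sub>v n" 
    and Av: "(D * mat_adjoint D * P) *\<^sub>v v = e \<cdot>\<^sub>v v"
    using ev D unfolding P_def[symmetric] eigenvalue_def eigenvector_def by auto
  define w where "w = P *\<^sub>v v"
  have w: "w \<in> carrier_vec n" using P v by (auto simp: w_def)
  have Dw: "mat_adjoint D *\<^sub>v w \<in> carrier_vec t"
    using D w by (meson mat_adjoint_carrier mult_mat_vec_carrier)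
  have "e \<cdot>\<^sub>v v = D *\<^sub>v (mat_adjoint D *\<^sub>v w)"
    using D P v unfolding Av[symmetric] w_def
    by (simp add: assoc_mult_mat_vec[of _ n n _ n] assoc_mult_mat_vec[of _ n t _ n])
  then have "(e \<cdot>\<^sub>v v) \<bullet>c w = (mat_adjoint D *\<^sub>v w) \<bullet>c (mat_adjoint D *\<^sub>v w)"
    using cscalar_prod_adjoint[OF D Dw w] by simp
  then have "e * (v \<bullet>c w) = (mat_adjoint D *\<^sub>v w) \<bullet>c (mat_adjoint D *\<^sub>v w)"
    using v w by simp
  then have "0 \<le> e * (v \<bullet>c w)"
    using conjugate_square_ge_0_vec by simp
  moreover have "0 < v \<bullet>c w" unfolding w_def P_def using gram_mult_pos[OF H v c] .
  moreover have "0 \<le> e'" if "0 < p" "0 \<le> e' * p" for e' p :: complex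
    using that by (auto simp: less_complex_def less_eq_complex_def zero_le_mult_iff)
  ultimately show ?thesis by blast
qed

lemma prod_list_nonneg_complex:
  assumes "\<forall>e\<in>set es. (0::complex) \<le> e"
  shows "prod_list es = complex_of_real (prod_list (map Re es))"
    "sum_list es = complex_of_real (sum_list (map Re es))"
  using assms by (induction es) (auto simp: less_eq_complex_def complex_eq_iff)

lemma det_gram_nonneg:
  fixes D :: "complex mat"
  assumes D: "D \<in> carrier_mat n t"
  shows "0 \<le> det (D * mat_adjoint D)"
proof -
  have A: "D * mat_adjoint D \<in> carrier_mat n n" using D by auto
  obtain es where es: "\<And>e. e \<in> set es \<Longrightarrow> eigenvalue (D * mat_adjoint D) e"
    "det (D * mat_adjoint D) = prod_list es"
    using det_trace_eigenvalues[OF A] by metis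
  \<comment> \<open>A matrix \<open>H\<close> without rows and \<open>c = 0\<close> turn
    \<open>P\<close> into the identity, so that the eigenvalue lemma speaks of the Gram matrix
    alone.\<close>
  have "1\<^sub>m n + complex_of_real 0 \<cdot>\<^sub>m (mat_adjoint (0\<^sub>m 0 n) * 0\<^sub>m 0 n) = 1\<^sub>m n"
    by (intro eq_matI) auto
  then have "D * mat_adjoint D * (1\<^sub>m n + complex_of_real 0 \<cdot>\<^sub>m (mat_adjoint (0\<^sub>m 0 n) * 0\<^sub>m 0 n)) = D * mat_adjoint D"
    using right_mult_one_mat[OF A] by simp
  with es eigenvalue_gram_mult_nonneg[OF D, of "0\<^sub>m 0 n" 0 0] have "0 \<le> e" if "e \<in> set es" for e
    using that by simp
  note nonneg = this
  have "0 \<le> prod_list (map Re es)"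
    using nonneg by (intro prod_list_nonneg) (auto simp: less_eq_complex_def)
  moreover have "prod_list es = complex_of_real (prod_list (map Re es))"
    using nonneg by (intro prod_list_nonneg_complex) blast
  ultimately show ?thesis
    unfolding es(2) by (simp add: less_eq_complex_def)
qed

lemma mat_adjoint_one: "mat_adjoint (1\<^sub>m n :: complex mat) = 1\<^sub>m n"
  by (intro eq_matI) auto

text \<open>Taking the identity for \<open>D\<close> in the eigenvalue lemma makes all eigenvalues
  of \<open>P\<close> nonnegative; a kernel vector would contradict the positivity of the quadratic
  form.\<close>

lemma det_one_plus_gram_pos:
  fixes H :: "complex mat"
  assumes H: "H \<in> carrier_mat m n" and c: "0 \<le> c"
  defines "P \<equiv> 1\<^sub>m n + complex_of_real c \<cdot>\<^sub>m (mat_adjoint H * H)"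
  shows "0 < det P"
proof -
  have P: "P \<in> carrier_mat n n" using H by (auto simp: P_def)
  obtain es where es: "\<And>e. e \<in> set es \<Longrightarrow> eigenvalue P e" "det P = prod_list es"
    using det_trace_eigenvalues[OF P] by metis
  have "1\<^sub>m n * mat_adjoint (1\<^sub>m n) * P = P"
    using P by (simp add: mat_adjoint_one)
  with es(1) eigenvalue_gram_mult_nonneg[OF _ H c, of "1\<^sub>m n" n, folded P_def] 
  have "0 \<le> e" if "e \<in> set es" for e using that by simp
  then have nonneg: "\<forall>e\<in>set es. 0 \<le> e" by blast
  note prod_es = prod_list_nonneg_complex(1)[OF nonneg]
  have "det P \<noteq> 0"
  proof
    assume "det P = 0"
    then obtain v where v: "v \<in> carrier_vec n" "v \<noteq> 0\<^sub>v n" "P *\<^sub>v v = 0\<^sub>v n"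
      using det_0_iff_vec_prod_zero[OF P] by auto
    with gram_mult_pos[OF H v(1,2) c, folded P_def] show False by simp
  qed
  moreover have "0 \<le> prod_list (map Re es)"
    using nonneg by (intro prod_list_nonneg) (auto simp: less_eq_complex_def)
  ultimately show ?thesis
    using prod_es es(2) by (auto simp: less_complex_def order.order_iff_strict)
qed

text \<open>Outage is expressed with the receive-side matrix \<open>H * mat_adjoint H\<close>, but
  only the transmit-side one has the size required to multiply \<open>D * mat_adjoint D\<close>.
  Sylvester's identity links the two.\<close>

lemma det_one_plus_gram_swap:
  fixes H :: "complex mat"
  assumes H: "H \<in> carrier_mat m n"
  shows "det (1\<^sub>m m + c \<cdot>\<^sub>m (H * mat_adjoint H)) = det (1\<^sub>m n + c \<cdot>\<^sub>m (mat_adjoint H * H))"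
proof -
  have "c \<cdot>\<^sub>m (H * mat_adjoint H) = (c \<cdot>\<^sub>m H) * mat_adjoint H"
    "c \<cdot>\<^sub>m (mat_adjoint H * H) = mat_adjoint H * (c \<cdot>\<^sub>m H)"
    using H by (simp_all add: mult_smult_distrib[of "mat_adjoint H" n m H n] mult_smult_assoc_mat[of H m n "mat_adjoint H" m])
  then show ?thesis
    using det_one_plus_mult_commute[of "c \<cdot>\<^sub>m H" m n "mat_adjoint H"] H by simp
qed

section \<open>The determinant-trace inequality\<close>

lemma prod_list_le_power:
  fixes xs :: "'a::linordered_semidom list"
  assumes "\<And>x. x \<in> set xs \<Longrightarrow> 0 \<le> x" "\<And>x. x \<in> set xs \<Longrightarrow> x \<le> s"
  shows "prod_list xs \<le> s ^ length xs"
  using assms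
proof (induction xs)
  case (Cons x xs)
  then have "0 \<le> s" by (meson list.set_intros(1) order_trans)
  with Cons show ?case by (auto intro!: mult_mono prod_list_nonneg)
qed simp

text \<open>The left side is the product of the \<open>n\<close> nonnegative eigenvalues of
  \<open>D * mat_adjoint D * P\<close>, each of which is at most their sum, the trace. A free upper
  bound \<open>S\<close> of the trace lets all sub-channels share one bound.\<close>

lemma gram_det_le_frob:
  fixes D H :: "complex mat" and c :: real
  assumes D: "D \<in> carrier_mat n t" and H: "H \<in> carrier_mat m n" and c: "0 \<le> c"
    and S: "frob2 D + c * frob2 (H * D) \<le> S"
  shows "Re (det (D * mat_adjoint D)) *
      Re (det (1\<^sub>m m + complex_of_real c \<cdot>\<^sub>m (H * mat_adjoint H))) \<le> S ^ n"
proof -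
  define P where "P = 1\<^sub>m n + complex_of_real c \<cdot>\<^sub>m (mat_adjoint H * H)"
  have P: "P \<in> carrier_mat n n" using H by (auto simp: P_def)
  have DD: "D * mat_adjoint D \<in> carrier_mat n n" using D by auto
  then have K: "D * mat_adjoint D * P \<in> carrier_mat n n" using P by auto
  obtain es where es: "length es = n" "\<And>e. e \<in> set es \<Longrightarrow> eigenvalue (D * mat_adjoint D * P) e"
    "det (D * mat_adjoint D * P) = prod_list es" "mat_trace (D * mat_adjoint D * P) = sum_list es"
    using det_trace_eigenvalues[OF K] by metis
  have nonneg: "\<forall>e\<in>set es. 0 \<le> e"
    using es(2) eigenvalue_gram_mult_nonneg[OF D H c, folded P_def] by blast
  note real_es = prod_list_nonneg_complex[OF nonneg]
  \<comment> \<open>Since \<open>det P\<close> is real, the real part of the product of determinants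
    is the product of the real parts.\<close>
  have Im0: "Im (det P) = 0" using det_one_plus_gram_pos[OF H c, folded P_def]
    by (simp add: less_complex_def)
  have "prod_list (map Re es) = Re (det (D * mat_adjoint D) * det P)"
    using real_es(1) es(3) det_mult[OF DD P] by simp
  also have "\<dots> = Re (det (D * mat_adjoint D)) * Re (det P)"
    by (simp add: Im0)
  finally have prod: "prod_list (map Re es) = Re (det (D * mat_adjoint D)) * Re (det P)" .
  have HH: "mat_adjoint H * H \<in> carrier_mat n n" using H by auto
  have HD: "H * D \<in> carrier_mat m t" using H D by auto
  \<comment> \<open>By cyclicity the trace is that of \<open>mat_adjoint D * P * D\<close>, which
    splits into the Gram matrix of \<open>D\<close> and \<open>c\<close> times that of
    \<open>H * D\<close>.\<close>
  have "mat_trace (D * mat_adjoint D * P) = mat_trace (D * (mat_adjoint D * P))"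
    using D P by (simp add: assoc_mult_mat[of _ n t _ n _ n])
  also have "\<dots> = mat_trace (mat_adjoint D * P * D)"
    by (rule mat_trace_comm[of _ n t]) (use D P in auto)
  also have "mat_adjoint D * P * D = mat_adjoint D * (P * D)"
    by (rule assoc_mult_mat[of _ t n _ n _ t]) (use D P in auto)
  also have "P * D = D + complex_of_real c \<cdot>\<^sub>m (mat_adjoint H * (H * D))"
    unfolding P_def assoc_mult_mat[OF mat_adjoint_carrier[OF H] H D, symmetric]
      mult_smult_assoc_mat[OF HH D, symmetric]
    using add_mult_distrib_mat[OF one_carrier_mat smult_carrier_mat[OF HH] D] left_mult_one_mat[OF D] by simp
  also have "mat_adjoint D * (D + complex_of_real c \<cdot>\<^sub>m (mat_adjoint H * (H * D))) =
      mat_adjoint D * D + complex_of_real c \<cdot>\<^sub>m (mat_adjoint (H * D) * (H * D))"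
    using H D HD
    by (subst mult_add_distrib_mat[of _ t n _ t])
       (auto simp: mult_smult_distrib[of _ t n _ t] mat_adjoint_mult[OF H D] assoc_mult_mat[of _ t n _ m _ t])
  also have "mat_trace \<dots> = mat_trace (mat_adjoint D * D) + c * mat_trace (mat_adjoint (H * D) * (H * D))"
    using D HD by (simp add: mat_trace_def sum.distrib sum_distrib_left del: index_mult_mat(1))
  finally have "sum_list es = complex_of_real (frob2 D + c * frob2 (H * D))"
    using es(4) by (simp add: mat_trace_gram)
  then have "complex_of_real (sum_list (map Re es)) = complex_of_real (frob2 D + c * frob2 (H * D))"
    using real_es(2) by simp
  then have sum: "sum_list (map Re es) \<le> S"
    using S by (simp only: of_real_eq_iff)
  have Re_nonneg: "0 \<le> x" if "x \<in> set (map Re es)" for x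
    using that nonneg by (auto simp: less_eq_complex_def)
  have "x \<le> S" if "x \<in> set (map Re es)" for x
    using member_le_sum_list[OF that Re_nonneg] sum by simp
  with Re_nonneg have "prod_list (map Re es) \<le> S ^ length (map Re es)"
    by (intro prod_list_le_power)
  then show ?thesis
    unfolding prod det_one_plus_gram_swap[OF H] P_def using es(1) by simp
qed

section \<open>Exponential order\<close>

lemma elog_div_le_iff:
  assumes "1 < snr"
  shows "elog x / ereal (ln snr) \<le> ereal c \<longleftrightarrow> x \<le> snr powr c"
proof (cases "x \<le> 0")
  case True
  then have "x \<le> snr powr c" using powr_ge_zero order_trans by blast
  with True assms show ?thesis by (simp add: elog_def)
next
  case False
  have "elog x / ereal (ln snr) \<le> ereal c \<longleftrightarrow> ln x \<le> c * ln snr"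
    using False assms by (simp add: elog_def field_simps)
  also have "\<dots> \<longleftrightarrow> x \<le> snr powr c"
    using False assms by (simp add: powr_def) (metis exp_le_cancel_iff exp_ln not_le)
  finally show ?thesis .
qed

text \<open>Replaces the limit superior by eventual bounds by real powers of SNR, one for each real
  \<open>c\<close> above \<open>a\<close>; this includes \<open>a = -\<infinity>\<close>, where
  every \<open>c\<close> occurs. The converse inserts a real number between \<open>a\<close> and
  \<open>y\<close>.\<close>

lemma exp_le_iff:
  "exp_le q a \<longleftrightarrow> (\<forall>c. a < ereal c \<longrightarrow> (\<forall>\<^sub>F snr in at_top. q snr \<le> snr powr c))"
proof
  assume q: "exp_le q a"
  show "\<forall>c. a < ereal c \<longrightarrow> (\<forall>\<^sub>F snr in at_top. q snr \<le> snr powr c)"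
  proof (intro allI impI)
    fix c assume "a < ereal c"
    with q have "Limsup at_top (\<lambda>snr. elog (q snr) / ereal (ln snr)) < ereal c"
      unfolding exp_le_def by (rule le_less_trans)
    from Limsup_lessD[OF this] eventually_gt_at_top[of 1]
    show "\<forall>\<^sub>F snr in at_top. q snr \<le> snr powr c"
      by eventually_elim (simp add: elog_div_le_iff[symmetric])
  qed
next
  assume q: "\<forall>c. a < ereal c \<longrightarrow> (\<forall>\<^sub>F snr in at_top. q snr \<le> snr powr c)"
  show "exp_le q a"
    unfolding exp_le_def Limsup_le_iff
  proof (intro allI impI)
    fix y assume "a < y"
    then obtain c where c: "a < ereal c" "ereal c < y" using ereal_dense2 by blast
    from q c(1) have "\<forall>\<^sub>F snr in at_top. q snr \<le> snr powr c" by blast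
    then show "\<forall>\<^sub>F snr in at_top. elog (q snr) / ereal (ln snr) < y"
      using eventually_gt_at_top[of 1]
      by eventually_elim (meson c(2) elog_div_le_iff le_less_trans)
  qed
qed

lemma exp_eq_imp_exp_le: "exp_eq q a \<Longrightarrow> exp_le q a"
  unfolding exp_eq_def exp_le_def by (simp add: lim_imp_Limsup)

lemma exp_eq_lower:
  assumes "exp_eq q a" "ereal c < a"
  shows "\<forall>\<^sub>F snr in at_top. snr powr c \<le> q snr"
  using order_tendstoD(1)[OF assms[unfolded exp_eq_def]] eventually_gt_at_top[of 1]
  by eventually_elim (meson elog_div_le_iff linear not_le)

text \<open>A stretched exponential beats every power of SNR; this makes the contribution of large
  noise negligible against any diversity, even an infinite one.\<close>

lemma eventually_exp_powr_le_powr: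
  fixes K \<eta> c c0 :: real
  assumes "0 < K" "0 < \<eta>"
  shows "\<forall>\<^sub>F s in at_top. c0 * exp (- (K * s powr \<eta>)) \<le> s powr c"
proof -
  have "((\<lambda>s. c0 * exp (- (K * s powr \<eta>)) * s powr (-c)) \<longlongrightarrow> 0) at_top"
    using assms by real_asymp
  then have "\<forall>\<^sub>F s in at_top. c0 * exp (- (K * s powr \<eta>)) * s powr (-c) < 1"
    by (rule order_tendstoD) simp
  then show ?thesis
    using eventually_gt_at_top[of 0]
    by eventually_elim (simp add: powr_minus field_simps)
qed

lemma eventually_powr_mult_le:
  fixes c p q :: real
  assumes "p < q" and "0 < k"
  shows "\<forall>\<^sub>F s in at_top. c * s powr p \<le> k * s powr q"
proof -
  have "((\<lambda>s. c * s powr (p - q)) \<longlongrightarrow> 0) at_top"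
    using assms by real_asymp
  then have "\<forall>\<^sub>F s in at_top. c * s powr (p - q) < k"
    using assms(2) by (rule order_tendstoD)
  then show ?thesis
    using eventually_gt_at_top[of 0]
    by eventually_elim (simp add: powr_diff field_simps)
qed

lemma exp_le_add:
  assumes "exp_le f a" "exp_le g a"
  shows "exp_le (\<lambda>s. f s + g s) a"
  unfolding exp_le_iff
proof (intro allI impI)
  fix c assume "a < ereal c"
  \<comment> \<open>The gap between \<open>c'\<close> and \<open>c\<close> absorbs the factor 2 of
    the sum.\<close>
  then obtain c' where c': "a < ereal c'" "c' < c" using ereal_dense2 by fastforce
  from assms c'(1) have "\<forall>\<^sub>F s in at_top. f s \<le> s powr c'" "\<forall>\<^sub>F s in at_top. g s \<le> s powr c'"
    by (auto simp: exp_le_iff)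
  with eventually_powr_mult_le[OF c'(2), where k = 1 and c = 2, simplified]
  show "\<forall>\<^sub>F s in at_top. f s + g s \<le> s powr c"
    by eventually_elim auto
qed

lemma exp_le_mono:
  assumes "\<forall>\<^sub>F s in at_top. f s \<le> g s" "exp_le g a"
  shows "exp_le f a"
  unfolding exp_le_iff
proof (intro allI impI)
  fix c assume "a < ereal c"
  with assms(2) have "\<forall>\<^sub>F s in at_top. g s \<le> s powr c" by (auto simp: exp_le_iff)
  with assms(1) show "\<forall>\<^sub>F s in at_top. f s \<le> s powr c"
    by eventually_elim auto
qed

section \<open>Gaussian noise\<close>

text \<open>The density is the product of two real normal densities of variance
  \<open>\<sigma>\<^sup>2\<close> in the real and imaginary parts. Two variances occur below: 1/2
  for the noise itself and 1 for the comparison in its tail bound.\<close>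

lemma nn_integral_complex_gaussian:
  assumes "0 < \<sigma>"
  shows "(\<integral>\<^sup>+z. ennreal (exp (- (cmod z)\<^sup>2 / (2 * \<sigma>\<^sup>2)) / (2 * pi * \<sigma>\<^sup>2)) \<partial>lborel) = 1"
proof -
  have "(\<integral>\<^sup>+x. ennreal (normal_density 0 \<sigma> x) \<partial>lborel) = 1"
    using assms by (subst nn_integral_eq_integral) simp_all
  moreover have "(\<integral>\<^sup>+z. (\<Prod>b\<in>Basis. ennreal (normal_density 0 \<sigma> (inner (z::complex) b))) \<partial>lborel) =
      (\<Prod>b\<in>(Basis::complex set). \<integral>\<^sup>+x. ennreal (normal_density 0 \<sigma> x) \<partial>lborel)"
    by (rule nn_integral_lborel_prod) auto
  moreover have "(\<Prod>b\<in>Basis. ennreal (normal_density 0 \<sigma> (inner z b))) =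
      ennreal (exp (- (cmod z)\<^sup>2 / (2 * \<sigma>\<^sup>2)) / (2 * pi * \<sigma>\<^sup>2))" for z :: complex
  proof -
    have "normal_density 0 \<sigma> (Re z) * normal_density 0 \<sigma> (Im z) =
        exp (- (cmod z)\<^sup>2 / (2 * \<sigma>\<^sup>2)) / (2 * pi * \<sigma>\<^sup>2)"
    proof -
      have "sqrt (2 * pi * \<sigma>\<^sup>2) * sqrt (2 * pi * \<sigma>\<^sup>2) = 2 * pi * \<sigma>\<^sup>2" by simp
      moreover have "exp (- (Re z)\<^sup>2 / (2 * \<sigma>\<^sup>2)) * exp (- (Im z)\<^sup>2 / (2 * \<sigma>\<^sup>2)) = exp (- (cmod z)\<^sup>2 / (2 * \<sigma>\<^sup>2))"
        by (simp only: exp_add[symmetric] cmod_power2 add_divide_distrib[symmetric] minus_add_distrib)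
      ultimately show ?thesis
        by (simp only: normal_density_def diff_zero times_divide_times_eq mult_1 times_divide_eq_left
              times_divide_eq_right divide_divide_eq_left)
    qed
    then show ?thesis
      by (simp add: Basis_complex_def inner_complex_def ennreal_mult[symmetric])
  qed
  ultimately show ?thesis by simp
qed

definition cn_measure :: "complex measure" where
  "cn_measure = density lborel (\<lambda>z. ennreal (cn_pdf z))"

lemma measurable_cn_pdf [measurable]: "cn_pdf \<in> borel_measurable borel"
  unfolding cn_pdf_def[abs_def] by measurable

lemma prob_space_cn_measure: "prob_space cn_measure"
proof
  have "emeasure cn_measure (space cn_measure) = (\<integral>\<^sup>+z. ennreal (cn_pdf z) \<partial>lborel)"
    by (simp add: cn_measure_def emeasure_density)
  also have "\<dots> = 1"
    using nn_integral_complex_gaussian[of "1 / sqrt 2"]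
    by (simp add: cn_pdf_def power_divide)
  finally show "emeasure cn_measure (space cn_measure) = 1" .
qed

text \<open>Where the squared modulus is at least \<open>t\<close>, half of the exponent is bounded
  by \<open>- t / 2\<close>; the other half is, up to the factor 2, the Gaussian density with
  \<open>\<sigma> = 1\<close>, which integrates to 1.\<close>

lemma cn_measure_tail: "measure cn_measure {z. t \<le> (cmod z)\<^sup>2} \<le> 2 * exp (- t / 2)"
proof -
  have "emeasure cn_measure {z. t \<le> (cmod z)\<^sup>2} =
      (\<integral>\<^sup>+z. ennreal (cn_pdf z) * indicator {z. t \<le> (cmod z)\<^sup>2} z \<partial>lborel)"
    unfolding cn_measure_def by (rule emeasure_density) measurable
  also have "\<dots> \<le> (\<integral>\<^sup>+z. ennreal (2 * exp (- t / 2)) * ennreal (exp (- (cmod z)\<^sup>2 / 2) / (2 * pi)) \<partial>lborel)"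
  proof (rule nn_integral_mono)
    fix z :: complex
    have "cn_pdf z \<le> 2 * exp (- t / 2) * (exp (- (cmod z)\<^sup>2 / 2) / (2 * pi))" if "t \<le> (cmod z)\<^sup>2"
    proof -
      have "exp (- (cmod z)\<^sup>2) \<le> exp (- t / 2 + - (cmod z)\<^sup>2 / 2)"
        using that by (intro exp_mono) (simp add: field_simps)
      then show ?thesis by (simp only: cn_pdf_def exp_add) (simp add: field_simps)
    qed
    then show "ennreal (cn_pdf z) * indicator {z. t \<le> (cmod z)\<^sup>2} z \<le>
        ennreal (2 * exp (- t / 2)) * ennreal (exp (- (cmod z)\<^sup>2 / 2) / (2 * pi))"
      by (auto simp: indicator_def ennreal_mult[symmetric] intro!: ennreal_leI)
  qed
  also have "\<dots> = ennreal (2 * exp (- t / 2))"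
    using nn_integral_complex_gaussian[of 1] by (subst nn_integral_cmult) simp_all
  finally show ?thesis
    by (simp add: finite_measure.emeasure_eq_measure prob_space.finite_measure prob_space_cn_measure)
qed

section \<open>The noise over all received entries\<close>

lemma noise_eq: "noise nr T = PiM (noise_index nr T) (\<lambda>_. cn_measure)"
  by (simp add: noise_def cn_measure_def)

lemma finite_noise_index: "finite (noise_index (nr :: 'k::finite \<Rightarrow> nat) T)"
proof -
  have "noise_index nr T = (SIGMA k:UNIV. {..<nr k} \<times> {..<T})"
    by (auto simp: noise_index_def)
  then show ?thesis by simp
qed

lemma sum_noise_index:
  fixes nr :: "'k::finite \<Rightarrow> nat"
  shows "(\<Sum>p\<in>noise_index nr T. f p) = (\<Sum>k\<in>UNIV. \<Sum>i<nr k. \<Sum>j<T. f (k, i, j))"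
proof -
  have "noise_index nr T = (SIGMA k:UNIV. {..<nr k} \<times> {..<T})"
    by (auto simp: noise_index_def)
  then show ?thesis
    by (simp add: sum.Sigma sum.cartesian_product case_prod_unfold)
qed

lemma prob_space_noise: "prob_space (noise nr T)"
  unfolding noise_eq by (intro prob_space_PiM prob_space_cn_measure)

lemma noise_norm_measurable:
  fixes nr :: "'k::finite \<Rightarrow> nat"
  shows "{z \<in> space (noise nr T). t \<le> (\<Sum>p\<in>noise_index nr T. (cmod (z p))\<^sup>2)} \<in> sets (noise nr T)"
proof -
  have [measurable]: "(\<lambda>z. z p) \<in> measurable (noise nr T) borel" if "p \<in> noise_index nr T" for p
    using measurable_component_singleton[OF that, of "\<lambda>_. cn_measure"]
    by (simp add: noise_eq cn_measure_def measurable_def)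
  show ?thesis by measurable
qed

text \<open>If \<open>m\<close> squares sum to at least \<open>t\<close>, one of them is at least
  \<open>t / m\<close>; the union bound over the entries does the rest.\<close>

lemma noise_tail:
  fixes nr :: "'k::finite \<Rightarrow> nat" and T :: nat
  defines "m \<equiv> real (card (noise_index nr T))"
  assumes m: "0 < m"
  shows "measure (noise nr T) {z \<in> space (noise nr T). t \<le> (\<Sum>p\<in>noise_index nr T. (cmod (z p))\<^sup>2)}
    \<le> 2 * m * exp (- t / (2 * m))"
proof -
  interpret N: prob_space "noise nr T" by (rule prob_space_noise)
  let ?E = "\<lambda>p. {z \<in> space (noise nr T). z p \<in> {z. t / m \<le> (cmod z)\<^sup>2}}"
  interpret product_prob_space "\<lambda>_. cn_measure" "noise_index nr T"
    by (intro product_prob_spaceI prob_space_cn_measure)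
  have meas: "{z. t / m \<le> (cmod z)\<^sup>2} \<in> sets cn_measure"
    unfolding cn_measure_def by (simp add: borel_closed closed_Collect_le continuous_intros)
  have E: "?E p \<in> sets (noise nr T)" "measure (noise nr T) (?E p) \<le> 2 * exp (- (t / m) / 2)"
    if "p \<in> noise_index nr T" for p
  proof -
    show "?E p \<in> sets (noise nr T)"
      using that unfolding noise_eq by (intro sets_Collect_single meas)
    have "measure (noise nr T) (?E p) = measure cn_measure {z. t / m \<le> (cmod z)\<^sup>2}"
      using emeasure_PiM_Collect_single[OF that meas] unfolding noise_eq measure_def by simp
    then show "measure (noise nr T) (?E p) \<le> 2 * exp (- (t / m) / 2)"
      using cn_measure_tail[of "t / m"] by simp
  qed
  have "{z \<in> space (noise nr T). t \<le> (\<Sum>p\<in>noise_index nr T. (cmod (z p))\<^sup>2)} \<subseteq> (\<Union>p\<in>noise_index nr T. ?E p)"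
  proof (rule subsetI, rule ccontr)
    fix z assume z: "z \<in> {z \<in> space (noise nr T). t \<le> (\<Sum>p\<in>noise_index nr T. (cmod (z p))\<^sup>2)}"
      and "z \<notin> (\<Union>p\<in>noise_index nr T. ?E p)"
    then have "(cmod (z p))\<^sup>2 < t / m" if "p \<in> noise_index nr T" for p
      using that by force
    then have "(\<Sum>p\<in>noise_index nr T. (cmod (z p))\<^sup>2) < (\<Sum>p\<in>noise_index nr T. t / m)"
      using m by (intro sum_strict_mono finite_noise_index) (auto simp: m_def)
    also have "\<dots> = t" using m by (simp add: m_def)
    finally show False using z by simp
  qed
  then have "measure (noise nr T) {z \<in> space (noise nr T). t \<le> (\<Sum>p\<in>noise_index nr T. (cmod (z p))\<^sup>2)}
      \<le> measure (noise nr T) (\<Union>p\<in>noise_index nr T. ?E p)"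
    using E(1) finite_noise_index by (intro N.finite_measure_mono) auto
  also have "\<dots> \<le> (\<Sum>p\<in>noise_index nr T. measure (noise nr T) (?E p))"
    using E(1) finite_noise_index by (intro N.finite_measure_subadditive_finite) auto
  also have "\<dots> \<le> (\<Sum>p\<in>noise_index nr T. 2 * exp (- (t / m) / 2))"
    using E(2) by (rule sum_mono)
  also have "\<dots> = 2 * m * exp (- t / (2 * m))"
    by (simp add: m_def mult.commute)
  finally show ?thesis .
qed

section \<open>Error probability at fixed SNR\<close>

lemma frob2_diff_le:
  assumes "A \<in> carrier_mat n m" "B \<in> carrier_mat n m"
  shows "frob2 (A - B) \<le> 2 * frob2 A + 2 * frob2 B"
proof -
  have dims: "dim_row (A - B) = n" "dim_col (A - B) = m" using assms by auto
  have le: "(cmod (a - b))\<^sup>2 \<le> 2 * (cmod a)\<^sup>2 + 2 * (cmod b)\<^sup>2" for a b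
  proof -
    have "(cmod (a - b))\<^sup>2 \<le> (cmod a + cmod b)\<^sup>2"
      by (intro power_mono norm_triangle_ineq4) simp
    also have "\<dots> \<le> 2 * (cmod a)\<^sup>2 + 2 * (cmod b)\<^sup>2"
      using zero_le_power2[of "cmod a - cmod b"] by (simp add: power2_eq_square algebra_simps)
    finally show ?thesis .
  qed
  have "frob2 (A - B) \<le> (\<Sum>i<n. \<Sum>j<m. 2 * (cmod (A $$ (i, j)))\<^sup>2 + 2 * (cmod (B $$ (i, j)))\<^sup>2)"
    unfolding frob2_def dims
  proof (intro sum_mono)
    fix i j assume "i \<in> {..<n}" "j \<in> {..<m}"
    then show "(cmod ((A - B) $$ (i, j)))\<^sup>2 \<le> 2 * (cmod (A $$ (i, j)))\<^sup>2 + 2 * (cmod (B $$ (i, j)))\<^sup>2"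
      using le[of "A $$ (i, j)" "B $$ (i, j)"] assms by simp
  qed
  also have "\<dots> = 2 * frob2 A + 2 * frob2 B"
    using assms by (simp add: frob2_def sum.distrib sum_distrib_left)
  finally show ?thesis .
qed

lemma frob2_smult: "frob2 (c \<cdot>\<^sub>m A) = (cmod c)\<^sup>2 * frob2 A"
  by (simp add: frob2_def norm_mult power_mult_distrib sum_distrib_left)

lemma frob2_le_entries:
  assumes "A \<in> carrier_mat n m" "\<And>i j. i < n \<Longrightarrow> j < m \<Longrightarrow> (cmod (A $$ (i, j)))\<^sup>2 \<le> b"
  shows "frob2 A \<le> real n * real m * b"
proof -
  have "frob2 A \<le> (\<Sum>i<n. \<Sum>j<m. b)"
    unfolding frob2_def carrier_matD[OF assms(1)] by (intro sum_mono) (simp add: assms(2))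
  then show ?thesis by (simp add: mult.assoc)
qed

text \<open>The factor that follows the exponential does not depend on \<open>x\<close>, so maximum
  likelihood decoding is minimum distance decoding.\<close>

lemma likelihood_eq:
  fixes nr nt :: "'k::finite \<Rightarrow> nat"
  assumes "\<And>k. G k \<in> carrier_mat (nr k) (nt k)" "\<And>k. Y k \<in> carrier_mat (nr k) T"
    "\<And>k. x k \<in> carrier_mat (nt k) T"
  shows "likelihood nr T \<theta> G Y x =
    exp (- (\<Sum>k\<in>UNIV. frob2 (Y k - G k * (complex_of_real \<theta> \<cdot>\<^sub>m x k)))) * (\<Prod>k\<in>UNIV. (1 / pi) ^ (nr k * T))"
proof -
  have "(\<Prod>i<nr k. \<Prod>j<T. cn_pdf ((Y k - G k * (complex_of_real \<theta> \<cdot>\<^sub>m x k)) $$ (i, j))) =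
      exp (- frob2 (Y k - G k * (complex_of_real \<theta> \<cdot>\<^sub>m x k))) * (1 / pi) ^ (nr k * T)" (is "?l = _") for k
  proof -
    let ?E = "Y k - G k * (complex_of_real \<theta> \<cdot>\<^sub>m x k)"
    have dim: "dim_row ?E = nr k" "dim_col ?E = T" using assms(1)[of k] assms(3)[of k] by auto
    have "?l = (\<Prod>i<nr k. \<Prod>j<T. exp (- (cmod (?E $$ (i, j)))\<^sup>2) * (1 / pi))"
      by (simp add: cn_pdf_def)
    also have "\<dots> = (\<Prod>i<nr k. exp (- (\<Sum>j<T. (cmod (?E $$ (i, j)))\<^sup>2)) * (1 / pi) ^ T)"
      by (simp only: prod.distrib sum_negf[symmetric] exp_sum[OF finite_lessThan] prod_constant card_lessThan)
    also have "\<dots> = exp (- frob2 ?E) * (1 / pi) ^ (nr k * T)"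
      by (simp only: frob2_def dim prod.distrib sum_negf[symmetric] exp_sum[OF finite_lessThan]
            prod_constant card_lessThan power_mult[symmetric] mult.commute)
    finally show ?thesis .
  qed
  then show ?thesis
    unfolding likelihood_def
    by (simp only: prod.distrib sum_negf[symmetric] exp_sum[OF finite])
qed

text \<open>The residual of the sent word is the noise, and that of \<open>x'\<close> is no larger
  if \<open>x'\<close> is at least as likely. Their difference is \<open>\<theta>\<close> times the
  received difference, so the triangle inequality for squares gives the factor 2 + 2.\<close>

lemma ml_error_imp_noise_large:
  fixes nr nt :: "'k::finite \<Rightarrow> nat"
  assumes G: "\<And>k. G k \<in> carrier_mat (nr k) (nt k)"
    and x: "\<And>k. x k \<in> carrier_mat (nt k) T" and x': "\<And>k. x' k \<in> carrier_mat (nt k) T"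
    and ml: "likelihood nr T \<theta> G (received nr T \<theta> G x z) x \<le> likelihood nr T \<theta> G (received nr T \<theta> G x z) x'"
  shows "\<theta>\<^sup>2 * (\<Sum>k\<in>UNIV. frob2 (G k * (x k - x' k))) \<le> 4 * (\<Sum>p\<in>noise_index nr T. (cmod (z p))\<^sup>2)"
proof -
  define Y where "Y = received nr T \<theta> G x z"
  have Y: "Y k \<in> carrier_mat (nr k) T" for k
    using G[of k] x[of k] by (auto simp: Y_def received_def noise_mat_def)
  define E where "E = (\<lambda>x k. Y k - G k * (complex_of_real \<theta> \<cdot>\<^sub>m x k))"
  have E: "E x k \<in> carrier_mat (nr k) T" if "x k \<in> carrier_mat (nt k) T" for x k
    using G[of k] Y[of k] that by (auto simp: E_def)
  have "0 < (\<Prod>k\<in>(UNIV::'k set). (1 / pi) ^ (nr k * T))" by (intro prod_pos) simp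
  with ml have le: "(\<Sum>k\<in>UNIV. frob2 (E x' k)) \<le> (\<Sum>k\<in>UNIV. frob2 (E x k))"
    unfolding Y_def[symmetric] likelihood_eq[of G nr nt Y T, OF G Y x] likelihood_eq[of G nr nt Y T, OF G Y x'] E_def
    by simp
  have "E x k = noise_mat nr T z k" for k
    unfolding E_def Y_def received_def using G[of k] x[of k]
    by (intro eq_matI) (auto simp: noise_mat_def)
  then have noise: "(\<Sum>k\<in>UNIV. frob2 (E x k)) = (\<Sum>p\<in>noise_index nr T. (cmod (z p))\<^sup>2)"
    by (simp add: sum_noise_index frob2_def noise_mat_def)
  have "E x' k - E x k = complex_of_real \<theta> \<cdot>\<^sub>m (G k * (x k - x' k))" for k
    unfolding E_def using G[of k] x[of k] x'[of k] Y[of k]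
    by (intro eq_matI) (auto simp: scalar_prod_def sum_distrib_left sum_subtractf[symmetric] algebra_simps)
  then have "\<theta>\<^sup>2 * frob2 (G k * (x k - x' k)) = frob2 (E x' k - E x k)" for k
    by (simp add: frob2_smult)
  also have "\<dots> k \<le> 2 * frob2 (E x' k) + 2 * frob2 (E x k)" for k
    by (rule frob2_diff_le[OF E[OF x'] E[OF x]])
  finally have "\<theta>\<^sup>2 * (\<Sum>k\<in>UNIV. frob2 (G k * (x k - x' k))) \<le>
      (\<Sum>k\<in>UNIV. 2 * frob2 (E x' k) + 2 * frob2 (E x k))"
    unfolding sum_distrib_left by (intro sum_mono)
  also have "\<dots> \<le> 4 * (\<Sum>k\<in>UNIV. frob2 (E x k))"
    using le by (simp add: sum.distrib sum_distrib_left[symmetric])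
  finally show ?thesis unfolding noise .
qed

section \<open>Measurability of the outage event\<close>

lemma measurable_det:
  fixes A :: "'w \<Rightarrow> complex mat"
  assumes A: "\<And>\<omega>. \<omega> \<in> space M \<Longrightarrow> A \<omega> \<in> carrier_mat n n"
    and entries: "\<And>i j. i < n \<Longrightarrow> j < n \<Longrightarrow> (\<lambda>\<omega>. A \<omega> $$ (i, j)) \<in> borel_measurable M"
  shows "(\<lambda>\<omega>. det (A \<omega>)) \<in> borel_measurable M"
proof -
  have "(\<lambda>\<omega>. \<Sum>p\<in>{p. p permutes {0..<n}}. signof p * (\<Prod>i = 0..<n. A \<omega> $$ (i, p i))) \<in> borel_measurable M"
    by (intro borel_measurable_sum borel_measurable_times borel_measurable_const
          borel_measurable_prod entries) (auto simp: permutes_in_image)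
  then show ?thesis
    by (subst measurable_cong[OF det_def'[OF A]])
qed

text \<open>The fading is measurable entry by entry only; by the Leibniz formula the determinants
  are polynomials in the entries and their conjugates.\<close>

lemma outage_measurable:
  fixes nr nt :: "'k::finite \<Rightarrow> nat"
  assumes "fading nt nr M H"
  shows "{\<omega> \<in> space M. (\<Sum>k\<in>UNIV. ln (Re (det (1\<^sub>m (nr k) +
        complex_of_real snr \<cdot>\<^sub>m (H \<omega> k * mat_adjoint (H \<omega> k)))))) < c} \<in> sets M"
proof -
  have H: "\<And>\<omega> k. \<omega> \<in> space M \<Longrightarrow> H \<omega> k \<in> carrier_mat (nr k) (nt k)"
    and meas: "\<And>k i j. i < nr k \<Longrightarrow> j < nt k \<Longrightarrow> (\<lambda>\<omega>. H \<omega> k $$ (i, j)) \<in> borel_measurable M"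
    using assms by (auto simp: fading_def)
  have meas_cnj: "(\<lambda>\<omega>. cnj (H \<omega> k $$ (i, j))) \<in> borel_measurable M" if "i < nr k" "j < nt k" for k i j
    by (rule borel_measurable_continuous_on[OF _ meas[OF that]]) (intro continuous_intros)
  have [measurable]: "(\<lambda>\<omega>. det (1\<^sub>m (nr k) +
      complex_of_real snr \<cdot>\<^sub>m (H \<omega> k * mat_adjoint (H \<omega> k)))) \<in> borel_measurable M" for k
  proof (rule measurable_det[where n = "nr k"])
    fix \<omega> assume "\<omega> \<in> space M"
    from H[OF this, of k]
    show "1\<^sub>m (nr k) + complex_of_real snr \<cdot>\<^sub>m (H \<omega> k * mat_adjoint (H \<omega> k)) \<in> carrier_mat (nr k) (nr k)"
      by auto
  next
    fix i j assume ij: "i < nr k" "j < nr k"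
    have "(\<lambda>\<omega>. (if i = j then 1 else 0) + complex_of_real snr *
        (\<Sum>l<nt k. H \<omega> k $$ (i, l) * cnj (H \<omega> k $$ (j, l)))) \<in> borel_measurable M"
      by (intro borel_measurable_add borel_measurable_times borel_measurable_const borel_measurable_sum
            meas_cnj meas) (use ij in auto)
    also have "?this \<longleftrightarrow> (\<lambda>\<omega>. (1\<^sub>m (nr k) + complex_of_real snr \<cdot>\<^sub>m (H \<omega> k * mat_adjoint (H \<omega> k))) $$ (i, j))
        \<in> borel_measurable M"
    proof (rule measurable_cong)
      fix \<omega> assume "\<omega> \<in> space M"
      from H[OF this, of k] ij
      show "(if i = j then 1 else 0) + complex_of_real snr * (\<Sum>l<nt k. H \<omega> k $$ (i, l) * cnj (H \<omega> k $$ (j, l)))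
          = (1\<^sub>m (nr k) + complex_of_real snr \<cdot>\<^sub>m (H \<omega> k * mat_adjoint (H \<omega> k))) $$ (i, j)"
        by (auto simp: scalar_prod_def lessThan_atLeast0)
    qed
    finally show "(\<lambda>\<omega>. (1\<^sub>m (nr k) + complex_of_real snr \<cdot>\<^sub>m (H \<omega> k * mat_adjoint (H \<omega> k))) $$ (i, j))
        \<in> borel_measurable M" .
  qed
  show ?thesis by measurable
qed

section \<open>Received distance outside outage and the error bound\<close>

text \<open>Neither the code determinants nor the channel determinants are bounded below on a single
  sub-channel, only their products over \<open>k\<close> are. Bounding every sub-channel by the same
  total \<open>S\<close> makes the exponents \<open>nt k\<close> add up to \<open>n\<close>, so both
  products enter at once and an \<open>n\<close>-th root finishes.\<close>

lemma nvd_distance: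
  fixes nr nt :: "'k::finite \<Rightarrow> nat"
  defines "n \<equiv> \<Sum>k\<in>UNIV. nt k"
  assumes G: "\<And>k. G k \<in> carrier_mat (nr k) (nt k)" and D: "\<And>k. D k \<in> carrier_mat (nt k) T"
    and snr: "1 < snr" and n: "0 < n"
    and no_outage: "r * ln snr \<le> (\<Sum>k\<in>UNIV. ln (Re (det (1\<^sub>m (nr k) +
        complex_of_real snr \<cdot>\<^sub>m (G k * mat_adjoint (G k))))))"
    and nvd: "\<kappa> \<le> (\<Prod>k\<in>UNIV. Re (det (D k * mat_adjoint (D k))))"
    and \<sigma>: "\<sigma> ^ n \<le> \<kappa> * snr powr r" and "0 < \<kappa>"
  shows "\<sigma> \<le> (\<Sum>k\<in>UNIV. frob2 (D k)) + snr * (\<Sum>k\<in>UNIV. frob2 (G k * D k))"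
proof -
  define S where "S = (\<Sum>k\<in>UNIV. frob2 (D k) + snr * frob2 (G k * D k))"
  let ?P = "\<lambda>k. Re (det (1\<^sub>m (nr k) + complex_of_real snr \<cdot>\<^sub>m (G k * mat_adjoint (G k))))"
  let ?A = "\<lambda>k. Re (det (D k * mat_adjoint (D k)))"
  have P: "0 < ?P k" for k
    using det_one_plus_gram_pos[OF G[of k], of snr] snr
    by (simp add: det_one_plus_gram_swap[OF G] less_complex_def)
  have A: "0 \<le> ?A k" for k
    using det_gram_nonneg[OF D[of k]] by (simp add: less_eq_complex_def)
  have summand: "0 \<le> frob2 (D k) + snr * frob2 (G k * D k)" for k
    using snr by (simp add: frob2_nonneg)
  have S0: "0 \<le> S"
    unfolding S_def by (rule sum_nonneg) (rule summand)
  have S: "frob2 (D k) + snr * frob2 (G k * D k) \<le> S" for k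
    unfolding S_def
    by (rule member_le_sum[where f = "\<lambda>k. frob2 (D k) + snr * frob2 (G k * D k)", OF UNIV_I summand finite])
  have "exp (r * ln snr) \<le> exp (ln (\<Prod>k\<in>UNIV. ?P k))"
    using no_outage P by (subst ln_prod) (auto simp: less_imp_neq[THEN not_sym])
  then have "snr powr r \<le> (\<Prod>k\<in>UNIV. ?P k)"
    using P snr by (simp add: powr_def prod_pos)
  then have "\<kappa> * snr powr r \<le> (\<Prod>k\<in>UNIV. ?A k) * (\<Prod>k\<in>UNIV. ?P k)"
    using nvd \<open>0 < \<kappa>\<close> A by (intro mult_mono prod_nonneg) auto
  also have "\<dots> = (\<Prod>k\<in>UNIV. ?A k * ?P k)" by (simp add: prod.distrib)
  also have "\<dots> \<le> (\<Prod>k\<in>UNIV. S ^ nt k)"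
    using A P gram_det_le_frob[OF D G _ S] snr
    by (intro prod_mono conjI mult_nonneg_nonneg) (auto simp: less_imp_le)
  also have "\<dots> = S ^ n" by (simp add: n_def power_sum)
  finally have "\<sigma> ^ n \<le> S ^ n" using \<sigma> by simp
  then have "\<sigma> \<le> S"
    using S0 n by (meson linorder_not_less power_strict_mono)
  then show ?thesis
    by (simp add: S_def sum.distrib sum_distrib_left)
qed

text \<open>An error forces outage at rate \<open>r\<close> or large noise: otherwise the received
  distance is too great for the noise to bridge. The bound is the same for every sent codeword,
  hence survives averaging.\<close>

lemma error_prob_le:
  fixes nr nt :: "'k::finite \<Rightarrow> nat" and T :: nat
  defines "n \<equiv> \<Sum>k\<in>UNIV. nt k" and "m \<equiv> real (card (noise_index nr T))"
  assumes fading: "fading nt nr M H" and ml: "ml_decoder nt nr T M H \<theta> C D"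
    and C: "\<And>x k. x \<in> C \<Longrightarrow> x k \<in> carrier_mat (nt k) T"
    and bound: "\<And>x k i j. x \<in> C \<Longrightarrow> i < nt k \<Longrightarrow> j < T \<Longrightarrow> (cmod (x k $$ (i, j)))\<^sup>2 \<le> b"
    and nvd: "\<And>x x'. x \<in> C \<Longrightarrow> x' \<in> C \<Longrightarrow> x \<noteq> x' \<Longrightarrow>
        \<kappa> \<le> (\<Prod>k\<in>UNIV. Re (det ((x k - x' k) * mat_adjoint (x k - x' k))))"
    and "0 < \<kappa>" "1 < snr" "0 < n" "0 < m"
    and \<sigma>: "\<sigma> ^ n \<le> \<kappa> * snr powr r" "8 * real n * real T * b \<le> \<sigma>"
  shows "error_prob nr T M H \<theta> C D \<le> outage_prob nr M H r snr + 2 * m * exp (- (\<theta>\<^sup>2 * \<sigma> / (8 * snr)) / (2 * m))"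
    (is "_ \<le> ?R")
proof -
  interpret M: prob_space M using fading by (simp add: fading_def)
  interpret N: prob_space "noise nr T" by (rule prob_space_noise)
  interpret MN: pair_prob_space M "noise nr T" ..
  have H: "H \<omega> k \<in> carrier_mat (nr k) (nt k)" if "\<omega> \<in> space M" for \<omega> k
    using fading that by (auto simp: fading_def)
  \<comment> \<open>The received distance before scaling will be at least
    \<open>\<sigma> / (2 * snr)\<close>, and an error needs a noise energy of at least a quarter of
    \<open>\<theta>\<^sup>2\<close> times that.\<close>
  define t where "t = \<theta>\<^sup>2 * \<sigma> / (8 * snr)"
  define Out where "Out = {\<omega> \<in> space M. (\<Sum>k\<in>UNIV. ln (Re (det (1\<^sub>m (nr k) +
        complex_of_real snr \<cdot>\<^sub>m (H \<omega> k * mat_adjoint (H \<omega> k)))))) < r * ln snr}"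
  define Big where "Big = {z \<in> space (noise nr T). t \<le> (\<Sum>p\<in>noise_index nr T. (cmod (z p))\<^sup>2)}"
  have Out: "Out \<in> sets M" unfolding Out_def by (rule outage_measurable[OF fading])
  have Big: "Big \<in> sets (noise nr T)" unfolding Big_def by (rule noise_norm_measurable)
  have times: "measure (M \<Otimes>\<^sub>M noise nr T) (A \<times> B) = measure M A * measure (noise nr T) B"
    if "A \<in> sets M" "B \<in> sets (noise nr T)" for A B
    using N.emeasure_pair_measure_Times[OF that] by (simp add: measure_def enn2real_mult)
  let ?err = "\<lambda>x. {(\<omega>, z) \<in> space (M \<Otimes>\<^sub>M noise nr T). D (H \<omega>) (received nr T \<theta> (H \<omega>) x z) \<noteq> x}"
  have "measure (M \<Otimes>\<^sub>M noise nr T) (?err x) \<le> ?R" if x: "x \<in> C" for x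
  proof -
    have "?err x \<subseteq> Out \<times> space (noise nr T) \<union> space M \<times> Big"
    proof (rule subsetI, rule ccontr)
      fix p assume "p \<in> ?err x" and notin: "p \<notin> Out \<times> space (noise nr T) \<union> space M \<times> Big"
      then obtain \<omega> z where p: "p = (\<omega>, z)" and \<omega>: "\<omega> \<in> space M" and "z \<in> space (noise nr T)"
        and neq: "D (H \<omega>) (received nr T \<theta> (H \<omega>) x z) \<noteq> x"
        by (auto simp: space_pair_measure)
      then have z: "z \<in> space (noise nr T)" "z \<notin> Big" and \<omega>_out: "\<omega> \<notin> Out"
        using notin by auto
      define x' where "x' = D (H \<omega>) (received nr T \<theta> (H \<omega>) x z)"
      have "\<forall>k. H \<omega> k \<in> carrier_mat (nr k) (nt k) \<and> received nr T \<theta> (H \<omega>) x z k \<in> carrier_mat (nr k) T"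
        using H[OF \<omega>] C[OF x] by (auto simp: received_def noise_mat_def)
      with ml x have x': "x' \<in> C"
        "likelihood nr T \<theta> (H \<omega>) (received nr T \<theta> (H \<omega>) x z) x \<le>
         likelihood nr T \<theta> (H \<omega>) (received nr T \<theta> (H \<omega>) x z) x'"
        by (auto simp: ml_decoder_def x'_def)
      let ?d = "\<lambda>k. x k - x' k"
      have d: "?d k \<in> carrier_mat (nt k) T" for k by (rule minus_carrier_mat[OF C[OF x'(1)]])
      \<comment> \<open>The energy of the difference is at most \<open>4 * n * T * b\<close>, hence
        takes up at most half of \<open>\<sigma>\<close>; the other half is left for the received
        distance.\<close>
      have "frob2 (?d k) \<le> 2 * frob2 (x k) + 2 * frob2 (x' k)" for k
        by (rule frob2_diff_le[OF C[OF x] C[OF x'(1)]])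
      also have "\<dots> k \<le> 2 * (real (nt k) * real T * b) + 2 * (real (nt k) * real T * b)" for k
        using frob2_le_entries[OF C[OF x, of k] bound[OF x]] frob2_le_entries[OF C[OF x'(1), of k] bound[OF x'(1)]]
        by (intro add_mono) auto
      finally have "(\<Sum>k\<in>UNIV. frob2 (?d k)) \<le> (\<Sum>k\<in>UNIV. real (nt k) * (4 * real T * b))"
        by (intro sum_mono) (simp add: algebra_simps)
      also have "\<dots> = 4 * real n * real T * b"
        by (simp add: n_def sum_distrib_right[symmetric])
      finally have small: "2 * (\<Sum>k\<in>UNIV. frob2 (?d k)) \<le> \<sigma>" using \<sigma>(2) by simp
      have far: "\<theta>\<^sup>2 * (\<Sum>k\<in>UNIV. frob2 (H \<omega> k * ?d k)) < 4 * t"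
        using ml_error_imp_noise_large[of "H \<omega>" nr nt x T x', OF H[OF \<omega>] C[OF x] C[OF x'(1)] x'(2)] z
        by (auto simp: Big_def)
      from \<omega> \<omega>_out have "r * ln snr \<le> (\<Sum>k\<in>UNIV. ln (Re (det (1\<^sub>m (nr k) +
          complex_of_real snr \<cdot>\<^sub>m (H \<omega> k * mat_adjoint (H \<omega> k))))))"
        by (auto simp: Out_def)
      from nvd_distance[of "H \<omega>" nr nt ?d, OF H[OF \<omega>] d \<open>1 < snr\<close> \<open>0 < n\<close>[unfolded n_def] this
          nvd[OF x x'(1)] \<sigma>(1)[unfolded n_def] \<open>0 < \<kappa>\<close>] neq
      have "\<sigma> \<le> (\<Sum>k\<in>UNIV. frob2 (?d k)) + snr * (\<Sum>k\<in>UNIV. frob2 (H \<omega> k * ?d k))"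
        by (auto simp: x'_def)
      with small have "\<sigma> / (2 * snr) \<le> (\<Sum>k\<in>UNIV. frob2 (H \<omega> k * ?d k))"
        using \<open>1 < snr\<close> by (simp add: field_simps)
      then have "\<theta>\<^sup>2 * (\<sigma> / (2 * snr)) \<le> \<theta>\<^sup>2 * (\<Sum>k\<in>UNIV. frob2 (H \<omega> k * ?d k))"
        by (intro mult_left_mono) auto
      with far show False by (simp add: t_def mult.commute)
    qed
    then have "measure (M \<Otimes>\<^sub>M noise nr T) (?err x) \<le>
        measure (M \<Otimes>\<^sub>M noise nr T) (Out \<times> space (noise nr T) \<union> space M \<times> Big)"
      using Out Big by (intro MN.finite_measure_mono) auto
    also have "\<dots> \<le> measure (M \<Otimes>\<^sub>M noise nr T) (Out \<times> space (noise nr T)) +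
        measure (M \<Otimes>\<^sub>M noise nr T) (space M \<times> Big)"
      using Out Big by (intro measure_Un_le) auto
    also have "\<dots> = measure M Out + measure (noise nr T) Big"
      using Out Big by (simp add: times M.prob_space N.prob_space)
    also have "\<dots> \<le> ?R"
      using noise_tail[of nr T t] \<open>0 < m\<close> unfolding m_def Big_def Out_def outage_prob_def t_def
      by simp
    finally show ?thesis .
  qed
  then have "(\<Sum>x\<in>C. measure (M \<Otimes>\<^sub>M noise nr T) (?err x)) \<le> real (card C) * ?R"
    by (rule sum_bounded_above)
  moreover have "0 \<le> ?R"
    using \<open>0 < m\<close> by (simp add: outage_prob_def)
  \<comment> \<open>If \<open>card C = 0\<close>, the error probability is a quotient by 0, hence
    0.\<close>
  ultimately show ?thesis
    unfolding error_prob_def by (cases "card C = 0") (auto simp: field_simps)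
qed

section \<open>Diversity\<close>

lemma linear_codeword_entry_le:
  assumes "s \<in> {..<L} \<rightarrow>\<^sub>E A" "finite A" "i < nt k" "j < T"
  shows "(cmod (linear_codeword nt T L W s k $$ (i, j)))\<^sup>2 \<le>
    (\<Sum>l<L. cmod (W k i j l))\<^sup>2 * Max ((\<lambda>s. (cmod s)\<^sup>2) ` A)"
proof -
  define c where "c = Max ((\<lambda>s. (cmod s)\<^sup>2) ` A)"
  have s: "(cmod (s l))\<^sup>2 \<le> c" if "l < L" for l
    unfolding c_def using assms(1,2) that by (intro Max_ge) auto
  have "cmod (linear_codeword nt T L W s k $$ (i, j)) \<le> (\<Sum>l<L. cmod (W k i j l) * sqrt c)"
    unfolding linear_codeword_def using assms(3,4) s
    by (auto simp: norm_mult intro!: sum_norm_le mult_left_mono real_le_rsqrt)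
  also have "\<dots> = (\<Sum>l<L. cmod (W k i j l)) * sqrt c" by (simp add: sum_distrib_right)
  finally have "(cmod (linear_codeword nt T L W s k $$ (i, j)))\<^sup>2 \<le> ((\<Sum>l<L. cmod (W k i j l)) * sqrt c)\<^sup>2"
    by (intro power_mono) auto
  \<comment> \<open>With \<open>L = 0\<close> the alphabet may be empty and \<open>Max\<close>
    unspecified, but then the sum of coefficients is 0. Otherwise the symbol \<open>s 0\<close>
    shows that \<open>c\<close> is nonnegative.\<close>
  moreover have "(sqrt c)\<^sup>2 = c \<or> L = 0"
  proof (cases "L = 0")
    case False
    with s[of 0] have "0 \<le> c" using order_trans[OF zero_le_power2] by blast
    then show ?thesis by simp
  qed simp
  ultimately show ?thesis by (auto simp: power_mult_distrib c_def)
qed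

text \<open>Serves to bound \<open>\<theta>\<close> from below: the power is of order SNR, while the
  entries of the unscaled code are bounded.\<close>

lemma avg_power_le:
  fixes nt :: "'k::finite \<Rightarrow> nat"
  assumes bound: "\<And>x k i j. x \<in> C \<Longrightarrow> i < nt k \<Longrightarrow> j < T \<Longrightarrow> (cmod (x k $$ (i, j)))\<^sup>2 \<le> b"
    and "0 < T" "0 \<le> b"
  shows "avg_power nt T \<theta> C \<le> \<theta>\<^sup>2 * real (\<Sum>k\<in>UNIV. nt k) * b"
proof -
  have "(\<Sum>k\<in>UNIV. \<Sum>i<nt k. \<Sum>j<T. (cmod (complex_of_real \<theta> * x k $$ (i, j)))\<^sup>2) \<le>
      \<theta>\<^sup>2 * real (\<Sum>k\<in>UNIV. nt k) * real T * b" if "x \<in> C" for x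
  proof -
    have "(\<Sum>k\<in>UNIV. \<Sum>i<nt k. \<Sum>j<T. (cmod (complex_of_real \<theta> * x k $$ (i, j)))\<^sup>2) \<le>
        (\<Sum>k\<in>UNIV. \<Sum>i<nt k. \<Sum>j<T. \<theta>\<^sup>2 * b)"
    proof (intro sum_mono)
      fix k i j assume "i \<in> {..<nt k}" "j \<in> {..<T}"
      then show "(cmod (complex_of_real \<theta> * x k $$ (i, j)))\<^sup>2 \<le> \<theta>\<^sup>2 * b"
        using bound[OF that, of i k j] by (simp add: norm_mult power_mult_distrib mult_left_mono)
    qed
    also have "\<dots> = \<theta>\<^sup>2 * real (\<Sum>k\<in>UNIV. nt k) * real T * b"
      by (simp add: sum_distrib_left sum_distrib_right mult_ac)
    finally show ?thesis .
  qed
  then have "(\<Sum>x\<in>C. \<Sum>k\<in>UNIV. \<Sum>i<nt k. \<Sum>j<T. (cmod (complex_of_real \<theta> * x k $$ (i, j)))\<^sup>2) \<le>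
      real (card C) * (\<theta>\<^sup>2 * real (\<Sum>k\<in>UNIV. nt k) * real T * b)"
    by (rule sum_bounded_above)
  moreover have "0 \<le> \<theta>\<^sup>2 * real (\<Sum>k\<in>UNIV. nt k) * b" using \<open>0 \<le> b\<close> by (simp del: of_nat_sum)
  ultimately show ?thesis
    unfolding avg_power_def using \<open>0 < T\<close>
    by (cases "card C = 0") (auto simp: field_simps simp del: of_nat_sum)
qed

section \<open>Choice of exponents and passage to the limit\<close>

text \<open>The code has multiplexing gain \<open>a * n\<close>, which is strictly below
  \<open>r'\<close>. The gap pays for all sub-polynomial losses and still leaves a noise threshold
  that grows as a positive power of SNR, so only outage at rate \<open>r'\<close> matters.\<close>

lemma error_exponent_le_of_larger_rate:
  fixes nt nr :: "'k::finite \<Rightarrow> nat" and T :: nat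
  defines "n \<equiv> \<Sum>k\<in>UNIV. nt k"
  assumes pos: "\<And>k. nt k > 0" "\<And>k. nr k > 0" "T > 0"
    and alphabet: "exp_eq (\<lambda>snr. real (card (Bs snr))) (ereal a)"
      "exp_le (\<lambda>snr. Max ((\<lambda>s. (cmod s)\<^sup>2) ` Bs snr)) (ereal a)"
    and a: "0 < a" "a < r' / real n"
    and code: "parallel_nvd_code nt T Bs X"
    and fading: "fading nt nr M H"
    and power: "exp_eq (\<lambda>snr. avg_power nt T (\<theta> snr) (X snr)) 1"
    and ml: "\<forall>\<^sub>F snr in at_top. ml_decoder nt nr T M H (\<theta> snr) (X snr) (D snr)"
    and outage: "exp_eq (outage_prob nr M H r') (- \<delta>)"
  shows "exp_le (\<lambda>snr. error_prob nr T M H (\<theta> snr) (X snr) (D snr)) (- \<delta>)"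
proof -
  define L where "L = T * n"
  define m where "m = real (card (noise_index nr T))"
  \<comment> \<open>Of the gap \<open>4 * \<epsilon>\<close>, one \<open>\<epsilon>\<close> is lost
    in the symbol energy and one in the power constraint; the noise threshold keeps the exponent
    \<open>2 * \<epsilon>\<close>.\<close>
  define \<epsilon> where "\<epsilon> = (r' / real n - a) / 4"
  have \<epsilon>: "0 < \<epsilon>" using a by (simp add: \<epsilon>_def)
  have n: "0 < n" unfolding n_def using pos(1) by (simp add: sum_pos)
  have rate: "r' / real n = a + 4 * \<epsilon>" using n by (simp add: \<epsilon>_def field_simps)
  have m: "0 < m"
    unfolding m_def using pos(2,3) finite_noise_index[of nr T]
    by (auto simp: card_gt_0_iff noise_index_def)
  obtain W where W: "\<forall>\<^sub>F snr in at_top. X snr = linear_codeword nt T L W ` ({..<L} \<rightarrow>\<^sub>E Bs snr)"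
  proof -
    obtain W where "\<forall>\<^sub>F snr in at_top. X snr = linear_codeword nt T L W ` ({..<L} \<rightarrow>\<^sub>E Bs snr) \<and>
        inj_on (linear_codeword nt T L W) ({..<L} \<rightarrow>\<^sub>E Bs snr)"
      using code unfolding parallel_nvd_code_def Let_def n_def L_def by blast
    then have "\<forall>\<^sub>F snr in at_top. X snr = linear_codeword nt T L W ` ({..<L} \<rightarrow>\<^sub>E Bs snr)"
      by (rule eventually_mono) blast
    then show thesis by (rule that)
  qed
  obtain \<kappa> where \<kappa>: "0 < \<kappa>" and nvd: "\<forall>\<^sub>F snr in at_top. \<forall>x\<in>X snr. \<forall>x'\<in>X snr. x \<noteq> x' \<longrightarrow>
        \<kappa> \<le> (\<Prod>k\<in>UNIV. Re (det ((x k - x' k) * mat_adjoint (x k - x' k))))"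
    using code unfolding parallel_nvd_code_def by blast
  \<comment> \<open>Dominates the coefficient factor of every entry and, as \<open>W\<close> is
    fixed, does not depend on SNR; the summand 1 keeps it positive.\<close>
  define w where "w = 1 + (\<Sum>k\<in>UNIV. \<Sum>i<nt k. \<Sum>j<T. (\<Sum>l<L. cmod (W k i j l))\<^sup>2)"
  have w: "0 < w" unfolding w_def by (intro add_pos_nonneg sum_nonneg) auto
  have W_le: "(\<Sum>l<L. cmod (W k i j l))\<^sup>2 \<le> w" if "i < nt k" "j < T" for k i j
  proof -
    have "(\<Sum>l<L. cmod (W k i j l))\<^sup>2 \<le> (\<Sum>j<T. (\<Sum>l<L. cmod (W k i j l))\<^sup>2)"
      using that by (intro member_le_sum[where f = "\<lambda>j. (\<Sum>l<L. cmod (W k i j l))\<^sup>2"]) auto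
    also have "\<dots> \<le> (\<Sum>i<nt k. \<Sum>j<T. (\<Sum>l<L. cmod (W k i j l))\<^sup>2)"
      using that by (intro member_le_sum[where f = "\<lambda>i. \<Sum>j<T. (\<Sum>l<L. cmod (W k i j l))\<^sup>2"] sum_nonneg) auto
    also have "\<dots> \<le> (\<Sum>k\<in>UNIV. \<Sum>i<nt k. \<Sum>j<T. (\<Sum>l<L. cmod (W k i j l))\<^sup>2)"
      by (intro member_le_sum[where f = "\<lambda>k. \<Sum>i<nt k. \<Sum>j<T. (\<Sum>l<L. cmod (W k i j l))\<^sup>2"] sum_nonneg) auto
    finally show ?thesis by (simp add: w_def)
  qed
  define b where "b = (\<lambda>snr. w * snr powr (a + \<epsilon>))"
  \<comment> \<open>The \<open>n\<close>-th root of \<open>\<kappa> * snr powr r'\<close>.\<close>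
  define \<sigma> where "\<sigma> = (\<lambda>snr. \<kappa> powr (1 / real n) * snr powr (r' / real n))"
  \<comment> \<open>Collects the constants of the noise exponent:
    \<open>\<kappa> powr (1 / real n)\<close> from \<open>\<sigma>\<close>,
    \<open>real n * w\<close> from the lower bound on \<open>\<theta>\<^sup>2\<close>, and 8 and
    \<open>2 * m\<close> from the error bound.\<close>
  define K where "K = \<kappa> powr (1 / real n) / (16 * m * real n * w)"
  have K: "0 < K" unfolding K_def using \<kappa> m n w by simp
  have "\<forall>\<^sub>F snr in at_top. finite (Bs snr)"
  proof -
    \<comment> \<open>As \<open>a > 0\<close>, the cardinality is eventually at least 1, which rules
      out infinite alphabets because their \<open>card\<close> is 0.\<close>
    have "\<forall>\<^sub>F snr in at_top. snr powr 0 \<le> real (card (Bs snr))"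
      by (rule exp_eq_lower[OF alphabet(1)]) (simp add: a)
    then show ?thesis using eventually_gt_at_top[of 0]
      by eventually_elim (metis card.infinite of_nat_0 powr_gt_zero not_less less_irrefl)
  qed
  moreover have "\<forall>\<^sub>F snr in at_top. Max ((\<lambda>s. (cmod s)\<^sup>2) ` Bs snr) \<le> snr powr (a + \<epsilon>)"
    using alphabet(2) \<epsilon> by (auto simp: exp_le_iff)
  moreover have "\<forall>\<^sub>F snr in at_top. snr powr (1 - \<epsilon>) \<le> avg_power nt T (\<theta> snr) (X snr)"
    by (rule exp_eq_lower[OF power]) (simp add: \<epsilon> one_ereal_def)
  moreover have "\<forall>\<^sub>F snr in at_top. 8 * real n * real T * b snr \<le> \<sigma> snr"
  proof -
    have "a + \<epsilon> < r' / real n" using \<epsilon> by (simp add: rate)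
    moreover have "0 < \<kappa> powr (1 / real n)" using \<kappa> by simp
    ultimately show ?thesis
      unfolding b_def \<sigma>_def
      using eventually_powr_mult_le[of "a + \<epsilon>" "r' / real n" "\<kappa> powr (1 / real n)" "8 * real n * real T * w"]
      by (simp add: mult.assoc)
  qed
  ultimately have error_le: "\<forall>\<^sub>F snr in at_top. error_prob nr T M H (\<theta> snr) (X snr) (D snr) \<le>
      outage_prob nr M H r' snr + 2 * m * exp (- (K * snr powr (2 * \<epsilon>)))"
    using W nvd ml eventually_gt_at_top[of 1]
  proof eventually_elim
    case (elim snr)
    have C: "x k \<in> carrier_mat (nt k) T" if "x \<in> X snr" for x k
      using that unfolding elim(5) by (rule imageE) (simp add: linear_codeword_def)
    have bound: "(cmod (x k $$ (i, j)))\<^sup>2 \<le> b snr" if x: "x \<in> X snr" and ij: "i < nt k" "j < T" for x k i j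
    proof -
      obtain s where s: "s \<in> {..<L} \<rightarrow>\<^sub>E Bs snr" "x = linear_codeword nt T L W s"
        using x unfolding elim(5) by (rule imageE)
      have "(cmod (x k $$ (i, j)))\<^sup>2 \<le> (\<Sum>l<L. cmod (W k i j l))\<^sup>2 * Max ((\<lambda>s. (cmod s)\<^sup>2) ` Bs snr)"
        unfolding s(2) by (intro linear_codeword_entry_le s(1) elim(1) ij)
      also have "\<dots> \<le> (\<Sum>l<L. cmod (W k i j l))\<^sup>2 * snr powr (a + \<epsilon>)"
        using elim(2) by (intro mult_left_mono) auto
      also have "\<dots> \<le> b snr"
        unfolding b_def using W_le[OF ij] by (intro mult_right_mono) auto
      finally show ?thesis .
    qed
    have "0 \<le> b snr" using w by (simp add: b_def)
    then have "avg_power nt T (\<theta> snr) (X snr) \<le> (\<theta> snr)\<^sup>2 * real n * b snr"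
      unfolding n_def by (intro avg_power_le bound pos(3))
    with elim(3) have "snr powr (1 - \<epsilon>) \<le> (\<theta> snr)\<^sup>2 * real n * b snr"
      by (rule order_trans)
    then have "snr powr (1 - \<epsilon>) \<le> (\<theta> snr)\<^sup>2 * (real n * w * snr powr (a + \<epsilon>))"
      by (simp add: b_def mult_ac)
    then have \<theta>: "snr powr (1 - \<epsilon>) / (real n * w * snr powr (a + \<epsilon>)) \<le> (\<theta> snr)\<^sup>2"
      using n w elim(8) by (simp add: divide_le_eq)
    have "K * snr powr (2 * \<epsilon>) = snr powr (1 - \<epsilon>) / (real n * w * snr powr (a + \<epsilon>)) * \<sigma> snr / (8 * snr) / (2 * m)"
    proof -
      have "snr powr (2 * \<epsilon>) * (snr powr (a + \<epsilon>) * snr powr 1) = snr powr (1 - \<epsilon>) * snr powr (a + 4 * \<epsilon>)"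
        unfolding powr_add[symmetric] by (simp add: algebra_simps)
      then have powers: "snr powr (2 * \<epsilon>) * (snr powr (a + \<epsilon>) * snr) = snr powr (1 - \<epsilon>) * snr powr (a + 4 * \<epsilon>)"
        using elim(8) by simp
      \<comment> \<open>The arithmetic of the constants, with the powers of SNR replaced by
        variables subject only to the balance of exponents in \<open>powers\<close>.\<close>
      have identity: "k / (16 * m * real n * w) * p = u / (real n * w * q) * (k * v) / (8 * s) / (2 * m)"
        if "p * (q * s) = u * v" "0 < q" "0 < s" for k p q s u v :: real
      proof -
        have "u / (real n * w * q) * (k * v) / (8 * s) / (2 * m) = k * (u * v) / (16 * m * real n * w * (q * s))"
          by (simp add: mult_ac)
        also have "\<dots> = k / (16 * m * real n * w) * p"
          using that(2,3) by (simp add: that(1)[symmetric])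
        finally show ?thesis ..
      qed
      show ?thesis
        unfolding K_def \<sigma>_def rate by (rule identity[OF powers]) (use elim(8) in auto)
    qed
    also have "\<dots> \<le> (\<theta> snr)\<^sup>2 * \<sigma> snr / (8 * snr) / (2 * m)"
      using m elim(8) by (intro divide_right_mono mult_right_mono \<theta>) (auto simp: \<sigma>_def)
    finally have exponent: "exp (- ((\<theta> snr)\<^sup>2 * \<sigma> snr / (8 * snr)) / (2 * m)) \<le> exp (- (K * snr powr (2 * \<epsilon>)))"
      by simp
    have "\<sigma> snr ^ n = \<kappa> * snr powr r'"
      using \<kappa> n elim(8) unfolding \<sigma>_def power_mult_distrib by (simp add: powr_power)
    then have \<sigma>_pow: "\<sigma> snr ^ n \<le> \<kappa> * snr powr r'" by simp
    have "error_prob nr T M H (\<theta> snr) (X snr) (D snr) \<le>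
        outage_prob nr M H r' snr + 2 * m * exp (- ((\<theta> snr)\<^sup>2 * \<sigma> snr / (8 * snr)) / (2 * m))"
      unfolding m_def
    proof (rule error_prob_le[OF fading elim(7) _ _ _ \<kappa> elim(8) n[unfolded n_def] m[unfolded m_def]
            \<sigma>_pow[unfolded n_def] elim(4)[unfolded n_def]])
      show "x k \<in> carrier_mat (nt k) T" if "x \<in> X snr" for x k
        using that by (rule C)
      show "(cmod (x k $$ (i, j)))\<^sup>2 \<le> b snr" if "x \<in> X snr" "i < nt k" "j < T" for x k i j
        using that by (rule bound)
      show "\<kappa> \<le> (\<Prod>k\<in>UNIV. Re (det ((x k - x' k) * mat_adjoint (x k - x' k))))"
        if "x \<in> X snr" "x' \<in> X snr" "x \<noteq> x'" for x x'
        using elim(6) that by blast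
    qed
    also have "\<dots> \<le> outage_prob nr M H r' snr + 2 * m * exp (- (K * snr powr (2 * \<epsilon>)))"
      using exponent m by (intro add_left_mono mult_left_mono) auto
    finally show ?case .
  qed
  have "exp_le (\<lambda>snr. 2 * m * exp (- (K * snr powr (2 * \<epsilon>)))) (- \<delta>)"
    unfolding exp_le_iff by (intro allI impI eventually_exp_powr_le_powr K) (simp add: \<epsilon>)
  from exp_le_add[OF exp_eq_imp_exp_le[OF outage] this]
  show ?thesis by (rule exp_le_mono[OF error_le])
qed

theorem mainTheorem9:
  fixes nt nr :: "'k::finite \<Rightarrow> nat" and T :: nat
    and B :: "real \<Rightarrow> real \<Rightarrow> complex set"
    and X :: "real \<Rightarrow> real \<Rightarrow> 'k codeword set"
    and M :: "'w measure" and H :: "'w \<Rightarrow> 'k \<Rightarrow> complex mat"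
    and d :: "real \<Rightarrow> ereal"
  assumes "\<And>k. nt k > 0" and "\<And>k. nr k > 0" and "T > 0"
    and alphabet: "scalably_dense B"
    and code: "\<And>a. 0 \<le> a \<Longrightarrow> a \<le> 1 \<Longrightarrow> parallel_nvd_code nt T (B a) (X a)"
    and fading: "fading nt nr M H"
    and dmt: "is_dmt nr M H d"
    and r: "0 < r" "r \<le> real (\<Sum>k\<in>UNIV. nt k)"
    and right_cont: "(d \<longlongrightarrow> d r) (at_right r)"
  shows "achieves_diversity nt nr T M H (X (r / real (\<Sum>k\<in>UNIV. nt k))) (d r)"
proof -
  define n where "n = (\<Sum>k\<in>UNIV. nt k)"
  have n: "0 < real n" using r by (simp add: n_def)
  \<comment> \<open>On average \<open>n\<close> symbols are sent per channel use, each from an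
    alphabet of about \<open>snr powr a\<close> elements, so the multiplexing gain is
    \<open>n * a\<close>.\<close>
  define a where "a = r / real n"
  have a: "0 < a" "a \<le> 1" using r n by (auto simp: a_def n_def)
  show ?thesis
    unfolding achieves_diversity_def n_def[symmetric] a_def[symmetric]
  proof (intro allI impI)
    fix \<theta> D
    assume power: "exp_eq (\<lambda>snr. avg_power nt T (\<theta> snr) (X a snr)) 1"
      and ml: "\<forall>\<^sub>F snr in at_top. ml_decoder nt nr T M H (\<theta> snr) (X a snr) (D snr)"
    let ?Pe = "\<lambda>snr. error_prob nr T M H (\<theta> snr) (X a snr) (D snr)"
    have "exp_le ?Pe (- d r')" if "r < r'" for r'
    proof (rule error_exponent_le_of_larger_rate[OF assms(1-3) _ _ a(1) _ _ fading power ml])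
      show "exp_eq (\<lambda>snr. real (card (B a snr))) (ereal a)"
        "exp_le (\<lambda>snr. Max ((\<lambda>s. (cmod s)\<^sup>2) ` B a snr)) (ereal a)"
        using alphabet a by (auto simp: scalably_dense_def)
      show "a < r' / real (\<Sum>k\<in>UNIV. nt k)"
        using that n unfolding a_def n_def[symmetric] by (simp add: divide_strict_right_mono)
      show "parallel_nvd_code nt T (B a) (X a)" using code a by simp
      show "exp_eq (outage_prob nr M H r') (- d r')" using dmt that r by (simp add: is_dmt_def)
    qed
    \<comment> \<open>The left side does not depend on \<open>r'\<close>, so the bound passes to the
      limit as \<open>r'\<close> decreases to \<open>r\<close>, where right continuity of
      \<open>d\<close> turns it into \<open>- d r\<close>.\<close>
    then have "\<forall>\<^sub>F r' in at_right r. Limsup at_top (\<lambda>snr. elog (?Pe snr) / ereal (ln snr)) \<le> - d r'"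
      unfolding exp_le_def eventually_at_right_field by (intro exI[of _ "r + 1"]) auto
    moreover have "((\<lambda>r'. - d r') \<longlongrightarrow> - d r) (at_right r)"
      using right_cont by (rule tendsto_uminus_ereal)
    ultimately show "exp_le ?Pe (- d r)"
      unfolding exp_le_def by (intro tendsto_lowerbound) auto
  qed
qed

end
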